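(* Let $s$ be a normalized complete Pick kernel on $X$ and $\ell$ a kernel on $X$ with $\ell/s$ positive semi-definite (and $\ell_z\neq0$ for all $z$). A sequence $\{\lambda_i\}\subset X$ is interpolating for $\mathrm{Mult}(\mathcal{H}_s,\mathcal{H}_\ell)$ if and only if it satisfies the Carleson measure condition for $\mathcal{H}_s$ and is strongly separated by $\ell$. Moreover, in this case there is a bounded linear operator $T:\ell^\infty\to\mathrm{Mult}(\mathcal{H}_s,\mathcal{H}_\ell)$ such that $[T(\{w_i\})](\lambda_j)=w_j\frac{\|\ell_{\lambda_j}\|}{\|s_{\lambda_j}\|}$ for every $\{w_i\}\in\ell^\infty$ and every $j$.
   Context: A kernel on $X$ is a positive semi-definite function $k:X\times X\to\mathbb{C}$; $\mathcal{H}_k$ its reproducing kernel Hilbert space, $k_w=k(\cdot,w)$, $\hat k_w=k_w/\|k_w\|$. A normalized complete Pick kernel is $s(z,w)=\frac{1}{1-\langle b(z),b(w)\rangle_{\mathcal K}}$ with $b$ into the open unit ball of a Hilbert space $\mathcal K$ and $b(w_0)=0$ for some $w_0$. "$\ell/s$ positive semi-definite" means $\ell=sg$ with $g$ a positive semi-definite kernel. $\mathrm{Mult}(\mathcal{H}_s,\mathcal{H}_\ell)$: functions $\phi$ with $f\mapsto \phi f$ bounded $\mathcal{H}_s\to\mathcal{H}_\ell$. $\{\lambda_i\}$ is interpolating for $\mathrm{Mult}(\mathcal{H}_s,\mathcal{H}_\ell)$ if for every bounded $\{w_i\}$ there is $\phi\in\mathrm{Mult}(\mathcal{H}_s,\mathcal{H}_\ell)$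 with $\phi(\lambda_i)=w_i\|\ell_{\lambda_i}\|/\|s_{\lambda_i}\|$ for all $i$. Carleson measure condition for $\mathcal{H}_s$: there is $C>0$ with $\sum_i|f(\lambda_i)|^2/\|s_{\lambda_i}\|^2\le C\|f\|^2$ for all $f\in\mathcal{H}_s$. $\{\lambda_i\}$ is strongly separated by $\ell$ if there is $\epsilon>0$ with $\mathrm{dist}(\hat\ell_{\lambda_i},\overline{\mathrm{span}}\{\hat\ell_{\lambda_j}:j\ne i\})\ge\epsilon$ for all $i$. *)

theory Defs
  imports "HOL-Analysis.Analysis"
begin

text \<open>Kernels on a set X are modelled as functions on a type 'x (X = UNIV).
  Convention: k z w = k(z,w), k_w = (\<lambda>z. k z w).\<close>

definition psd_kernel :: "('x \<Rightarrow> 'x \<Rightarrow> complex) \<Rightarrow> bool" where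
  "psd_kernel k \<longleftrightarrow>
     (\<forall>(n::nat) (x::nat \<Rightarrow> 'x) (c::nat \<Rightarrow> complex).
        (\<Sum>i<n. \<Sum>j<n. cnj (c i) * c j * k (x i) (x j)) \<in> \<real> \<and>
        0 \<le> Re (\<Sum>i<n. \<Sum>j<n. cnj (c i) * c j * k (x i) (x j)))"

text \<open>Reproducing kernel Hilbert space H_k, described as a space of functions
  (Aronszajn): f \<in> H_k iff C^2 k(z,w) - f(z) conj(f(w)) is psd for some C, and
  the norm of f is the least such C.\<close>

definition in_rkhs :: "('x \<Rightarrow> 'x \<Rightarrow> complex) \<Rightarrow> ('x \<Rightarrow> complex) \<Rightarrow> bool" where
  "in_rkhs k f \<longleftrightarrow> (\<exists>C::real. psd_kernel (\<lambda>z w. complex_of_real (C\<^sup>2) * k z w - f z * cnj (f w)))"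

definition rkhs_norm :: "('x \<Rightarrow> 'x \<Rightarrow> complex) \<Rightarrow> ('x \<Rightarrow> complex) \<Rightarrow> real" where
  "rkhs_norm k f = Inf {C::real. 0 \<le> C \<and>
       psd_kernel (\<lambda>z w. complex_of_real (C\<^sup>2) * k z w - f z * cnj (f w))}"

definition kfun_norm :: "('x \<Rightarrow> 'x \<Rightarrow> complex) \<Rightarrow> 'x \<Rightarrow> real" where
  "kfun_norm k w = rkhs_norm k (\<lambda>z. k z w)"

definition kfun_hat :: "('x \<Rightarrow> 'x \<Rightarrow> complex) \<Rightarrow> 'x \<Rightarrow> 'x \<Rightarrow> complex" where
  "kfun_hat k w = (\<lambda>z. k z w / complex_of_real (kfun_norm k w))"

text \<open>Normalized complete Pick kernel s(z,w) = 1/(1 - <b(z),b(w)>_K), with the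
  Hilbert space K realised as l^2('k) (every Hilbert space is of this form).\<close>
definition ncp_kernel :: "('x \<Rightarrow> 'k \<Rightarrow> complex) \<Rightarrow> ('x \<Rightarrow> 'x \<Rightarrow> complex) \<Rightarrow> bool" where
  "ncp_kernel b s \<longleftrightarrow>
     (\<forall>z. (\<lambda>j. (cmod (b z j))\<^sup>2) summable_on UNIV \<and> (\<Sum>\<^sub>\<infinity>j. (cmod (b z j))\<^sup>2) < 1) \<and>
     (\<exists>w0. \<forall>j. b w0 j = 0) \<and>
     (\<forall>z w. s z w = 1 / (1 - (\<Sum>\<^sub>\<infinity>j. b z j * cnj (b w j))))"

definition is_mult :: "('x \<Rightarrow> 'x \<Rightarrow> complex) \<Rightarrow> ('x \<Rightarrow> 'x \<Rightarrow> complex) \<Rightarrow> ('x \<Rightarrow> complex) \<Rightarrow> bool" where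
  "is_mult s l \<phi> \<longleftrightarrow> (\<exists>C::real. \<forall>f. in_rkhs s f \<longrightarrow>
      in_rkhs l (\<lambda>z. \<phi> z * f z) \<and> rkhs_norm l (\<lambda>z. \<phi> z * f z) \<le> C * rkhs_norm s f)"

definition mult_norm :: "('x \<Rightarrow> 'x \<Rightarrow> complex) \<Rightarrow> ('x \<Rightarrow> 'x \<Rightarrow> complex) \<Rightarrow> ('x \<Rightarrow> complex) \<Rightarrow> real" where
  "mult_norm s l \<phi> = Inf {C::real. 0 \<le> C \<and> (\<forall>f. in_rkhs s f \<longrightarrow>
      rkhs_norm l (\<lambda>z. \<phi> z * f z) \<le> C * rkhs_norm s f)}"

definition linfty :: "(nat \<Rightarrow> complex) set" where
  "linfty = {w. \<exists>B. \<forall>i. cmod (w i) \<le> B}"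

definition linfty_norm :: "(nat \<Rightarrow> complex) \<Rightarrow> real" where
  "linfty_norm w = (SUP i. cmod (w i))"

definition interpolating :: "('x \<Rightarrow> 'x \<Rightarrow> complex) \<Rightarrow> ('x \<Rightarrow> 'x \<Rightarrow> complex) \<Rightarrow> (nat \<Rightarrow> 'x) \<Rightarrow> bool" where
  "interpolating s l lam \<longleftrightarrow> (\<forall>w \<in> linfty. \<exists>\<phi>. is_mult s l \<phi> \<and>
      (\<forall>i. \<phi> (lam i) = w i * complex_of_real (kfun_norm l (lam i) / kfun_norm s (lam i))))"

definition carleson :: "('x \<Rightarrow> 'x \<Rightarrow> complex) \<Rightarrow> (nat \<Rightarrow> 'x) \<Rightarrow> bool" where
  "carleson s lam \<longleftrightarrow> (\<exists>C>0. \<forall>f. in_rkhs s f \<longrightarrow>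
      summable (\<lambda>i. (cmod (f (lam i)))\<^sup>2 / (kfun_norm s (lam i))\<^sup>2) \<and>
      (\<Sum>i. (cmod (f (lam i)))\<^sup>2 / (kfun_norm s (lam i))\<^sup>2) \<le> C * (rkhs_norm s f)\<^sup>2)"

definition fspan :: "(nat \<Rightarrow> 'x \<Rightarrow> complex) \<Rightarrow> nat set \<Rightarrow> ('x \<Rightarrow> complex) set" where
  "fspan u J = {(\<lambda>z. \<Sum>j\<in>F. c j * u j z) | F c. finite F \<and> F \<subseteq> J}"

definition rkhs_closed_span :: "('x \<Rightarrow> 'x \<Rightarrow> complex) \<Rightarrow> (nat \<Rightarrow> 'x \<Rightarrow> complex) \<Rightarrow> nat set \<Rightarrow> ('x \<Rightarrow> complex) set" where
  "rkhs_closed_span k u J = {h. in_rkhs k h \<and>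
      (\<forall>\<delta>>0. \<exists>g \<in> fspan u J. rkhs_norm k (\<lambda>z. h z - g z) < \<delta>)}"

definition rkhs_dist :: "('x \<Rightarrow> 'x \<Rightarrow> complex) \<Rightarrow> ('x \<Rightarrow> complex) \<Rightarrow> ('x \<Rightarrow> complex) set \<Rightarrow> real" where
  "rkhs_dist k v A = Inf ((\<lambda>h. rkhs_norm k (\<lambda>z. v z - h z)) ` A)"

definition strongly_separated :: "('x \<Rightarrow> 'x \<Rightarrow> complex) \<Rightarrow> (nat \<Rightarrow> 'x) \<Rightarrow> bool" where
  "strongly_separated l lam \<longleftrightarrow> (\<exists>\<epsilon>>0. \<forall>i.
      rkhs_dist l (kfun_hat l (lam i))
        (rkhs_closed_span l (\<lambda>j. kfun_hat l (lam j)) {j. j \<noteq> i}) \<ge> \<epsilon>)"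

end

theory Submission
  imports Defs "HOL-Library.Complex_Order" "Jordan_Normal_Form.Determinant"
begin

text \<open>Write \<open>s = 1 / (1 - \<beta>)\<close> and order kernels by \<open>p \<preceq> q\<close> iff \<open>s (q - p)\<close> is positive
  semi-definite. Multipliers from \<open>H\<^sub>s\<close> to \<open>H\<^sub>l\<close> of norm at most \<open>C\<close> are the functions \<open>\<phi>\<close> with
  \<open>C\<^sup>2 l - \<phi> \<phi>\<^sup>* s\<close> positive semi-definite.

  Sufficiency. The Carleson condition alone yields positive kernels \<open>\<gamma>\<^sub>i\<close> with \<open>\<Sum>\<gamma>\<^sub>i \<preceq> 1\<close> and
  \<open>\<gamma>\<^sub>i(\<lambda>\<^sub>i, \<lambda>\<^sub>i)\<close> bounded below. Multiplying the inequality that expresses strong separation at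
  \<open>\<lambda>\<^sub>i\<close> by \<open>\<gamma>\<^sub>i\<close> and summing over \<open>i\<close> shows that the normalized kernels of \<open>l\<close> are bounded below as
  a Riesz sequence. By Leech's theorem this lower bound provides a bounded row \<open>(R\<^sub>i)\<close> with
  \<open>R\<^sub>i(\<lambda>\<^sub>j) = \<delta>\<^sub>i\<^sub>j \<parallel>l\<^sub>\<lambda>\<^sub>i\<parallel> / \<parallel>s\<^sub>\<lambda>\<^sub>i\<parallel>\<close>, and the Carleson condition provides a bounded column \<open>(\<psi>\<^sub>i)\<close> with
  \<open>\<psi>\<^sub>i(\<lambda>\<^sub>i) = 1\<close>; then \<open>T w = \<Sum> w\<^sub>i R\<^sub>i \<psi>\<^sub>i\<close>. This is carried out for finitely many points, and
  Tychonoff's theorem gives the whole sequence.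

  Necessity. By Baire's theorem the norms of interpolating multipliers are uniformly bounded, so
  \<open>\<parallel>\<Sum> c\<^sub>i w\<^sub>i s\<^sub>i\<parallel> \<le> M \<parallel>\<Sum> c\<^sub>i l\<^sub>i\<parallel>\<close> for normalized kernels and \<open>\<bar>w\<^sub>i\<bar> \<le> 1\<close>. Strong separation is the case of a
  unit vector \<open>w\<close>, and the Carleson condition follows by choosing signs \<open>w\<^sub>i\<close> for which the right-hand
  side is at most \<open>M\<^sup>2 \<Sum>\<bar>c\<^sub>i\<bar>\<^sup>2\<close> after squaring.\<close>


subsection \<open>Positive semi-definite kernels\<close>

lemma complex_of_real_nonneg: "0 \<le> r \<Longrightarrow> 0 \<le> complex_of_real r"
  by (simp add: less_eq_complex_def)

text \<open>In the order of \<open>Complex_Order\<close>, \<open>0 \<le> q\<close> says both that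
  \<open>q\<close> is real and that its real part is nonnegative, so the two clauses of the
  definition merge into one inequality.\<close>

lemma psd_iff:
  "psd_kernel k \<longleftrightarrow>
     (\<forall>(n::nat) x c. 0 \<le> (\<Sum>i<n. \<Sum>j<n. cnj (c i) * c j * k (x i) (x j)))"
proof -
  have "0 \<le> q \<longleftrightarrow> q \<in> \<real> \<and> 0 \<le> Re q" for q
    by (auto simp: complex_is_Real_iff less_eq_complex_def)
  then show ?thesis unfolding psd_kernel_def by (simp only:)
qed

lemma psd_sum:
  assumes "psd_kernel k" "finite I"
  shows "0 \<le> (\<Sum>i\<in>I. \<Sum>j\<in>I. cnj (c i) * c j * k (x i) (x j))"
proof -
  obtain h where h: "bij_betw h {..<card I} I"
    using assms(2) ex_bij_betw_nat_finite lessThan_atLeast0 by metis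
  have "(\<Sum>i\<in>I. \<Sum>j\<in>I. cnj (c i) * c j * k (x i) (x j))
     = (\<Sum>i<card I. \<Sum>j<card I. cnj (c (h i)) * c (h j) * k (x (h i)) (x (h j)))"
    by (subst sum.reindex_bij_betw[OF h, symmetric], intro sum.cong refl)
       (subst sum.reindex_bij_betw[OF h, symmetric], rule refl)
  then show ?thesis
    using assms(1)[unfolded psd_iff, rule_format, where c = "c \<circ> h" and x = "x \<circ> h" and n = "card I"]
    by simp
qed

text \<open>Points that repeat in a list can be merged by adding up their coefficients, so it
  suffices to test finite sets of distinct points.\<close>

lemma psdI_finite:
  assumes "\<And>S c. finite S \<Longrightarrow> 0 \<le> (\<Sum>z\<in>S. \<Sum>w\<in>S. cnj (c z) * c w * k z w)"
  shows "psd_kernel k"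
  unfolding psd_iff
proof (intro allI)
  fix n :: nat and x :: "nat \<Rightarrow> 'a" and c :: "nat \<Rightarrow> complex"
  define S where "S = x ` {..<n}"
  define d where "d z = (\<Sum>i | i \<in> {..<n} \<and> x i = z. c i)" for z
  have g: "(\<Sum>i<n. c i * f (x i)) = (\<Sum>z\<in>S. d z * f z)" for f
  proof -
    have "(\<Sum>i<n. c i * f (x i)) = (\<Sum>z\<in>S. \<Sum>i | i \<in> {..<n} \<and> x i = z. c i * f (x i))"
      by (rule sum.group[symmetric]) (auto simp: S_def)
    then show ?thesis by (simp add: d_def sum_distrib_right)
  qed
  have g': "(\<Sum>i<n. cnj (c i) * f (x i)) = (\<Sum>z\<in>S. cnj (d z) * f z)" for f
    using g[of "\<lambda>x. cnj (f x)", THEN arg_cong[where f = cnj]] by simp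
  have "(\<Sum>i<n. \<Sum>j<n. cnj (c i) * c j * k (x i) (x j))
      = (\<Sum>i<n. cnj (c i) * (\<Sum>j<n. c j * k (x i) (x j)))"
    by (simp add: sum_distrib_left mult_ac)
  also have "\<dots> = (\<Sum>z\<in>S. cnj (d z) * (\<Sum>w\<in>S. d w * k z w))"
    by (simp add: g g'[of "\<lambda>z. \<Sum>w\<in>S. d w * k z w"])
  also have "\<dots> = (\<Sum>z\<in>S. \<Sum>w\<in>S. cnj (d z) * d w * k z w)"
    by (simp add: sum_distrib_left mult_ac)
  also have "0 \<le> \<dots>" by (rule assms) (simp add: S_def)
  finally show "0 \<le> (\<Sum>i<n. \<Sum>j<n. cnj (c i) * c j * k (x i) (x j))" .
qed

lemma psdI_nat:
  fixes k :: "nat \<Rightarrow> nat \<Rightarrow> complex"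
  assumes "\<And>n c. 0 \<le> (\<Sum>i<n. \<Sum>j<n. cnj (c i) * c j * k i j)"
  shows "psd_kernel k"
proof (rule psdI_finite)
  fix S :: "nat set" and c :: "nat \<Rightarrow> complex" assume S: "finite S"
  then obtain n where n: "S \<subseteq> {..<n}" by (meson finite_nat_iff_bounded)
  define d where "d i = (if i \<in> S then c i else 0)" for i
  have d: "(\<Sum>z\<in>S. f z) = (\<Sum>i<n. f i)" if "\<And>i. i \<notin> S \<Longrightarrow> f i = 0" for f :: "nat \<Rightarrow> complex"
    using n that by (intro sum.mono_neutral_left) auto
  have "(\<Sum>z\<in>S. \<Sum>w\<in>S. cnj (c z) * c w * k z w) = (\<Sum>z\<in>S. \<Sum>w\<in>S. cnj (d z) * d w * k z w)"
    by (simp add: d_def)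
  also have "\<dots> = (\<Sum>z\<in>S. \<Sum>j<n. cnj (d z) * d j * k z j)"
    by (intro sum.cong refl d) (simp add: d_def)
  also have "\<dots> = (\<Sum>i<n. \<Sum>j<n. cnj (d i) * d j * k i j)"
    by (intro d) (simp add: d_def)
  finally have "(\<Sum>z\<in>S. \<Sum>w\<in>S. cnj (c z) * c w * k z w) = (\<Sum>i<n. \<Sum>j<n. cnj (d i) * d j * k i j)" .
  with assms[of d n] show "0 \<le> (\<Sum>z\<in>S. \<Sum>w\<in>S. cnj (c z) * c w * k z w)" by simp
qed

text \<open>The form of \<open>k\<close> is evaluated at all points \<open>p i (x m)\<close> with
  coefficients \<open>c m * cnj (a i (x m))\<close>. Weights, pullbacks, differences and projections
  of kernels are instances.\<close>

lemma psd_combine: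
  assumes "psd_kernel k" "finite I"
  shows "psd_kernel (\<lambda>z w. \<Sum>i\<in>I. \<Sum>j\<in>I. a i z * cnj (a j w) * k (p i z) (p j w))"
  unfolding psd_iff
proof (intro allI)
  fix n :: nat and x :: "nat \<Rightarrow> 'c" and c :: "nat \<Rightarrow> complex"
  have "0 \<le> (\<Sum>u\<in>{..<n}\<times>I. \<Sum>v\<in>{..<n}\<times>I. cnj (c (fst u) * cnj (a (snd u) (x (fst u)))) *
      (c (fst v) * cnj (a (snd v) (x (fst v)))) * k (p (snd u) (x (fst u))) (p (snd v) (x (fst v))))"
    by (rule psd_sum) (use assms in auto)
  also have "\<dots> = (\<Sum>m<n. \<Sum>i\<in>I. \<Sum>m'<n. \<Sum>j\<in>I. cnj (c m) * c m' *
      (a i (x m) * cnj (a j (x m')) * k (p i (x m)) (p j (x m'))))"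
    unfolding sum.cartesian_product' by (simp add: mult_ac)
  also have "\<dots> = (\<Sum>m<n. \<Sum>m'<n. cnj (c m) * c m' * (\<Sum>i\<in>I. \<Sum>j\<in>I. a i (x m) *
      cnj (a j (x m')) * k (p i (x m)) (p j (x m'))))"
    by (intro sum.cong refl, subst sum.swap) (simp add: sum_distrib_left)
  finally show "0 \<le> \<dots>" .
qed

lemma psd_weight:
  assumes "psd_kernel k"
  shows "psd_kernel (\<lambda>z w. f z * cnj (f w) * k (p z) (p w))"
  using psd_combine[OF assms, of "{()}" "\<lambda>_. f" "\<lambda>_. p"] by simp

lemma psd_add:
  assumes "psd_kernel k" "psd_kernel k'"
  shows "psd_kernel (\<lambda>z w. k z w + k' z w)"
  unfolding psd_iff
proof (intro allI)
  fix n :: nat and x :: "nat \<Rightarrow> 'a" and c :: "nat \<Rightarrow> complex"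
  have "0 \<le> (\<Sum>i<n. \<Sum>j<n. cnj (c i) * c j * k (x i) (x j)) + (\<Sum>i<n. \<Sum>j<n. cnj (c i) * c j * k' (x i) (x j))"
    by (rule add_nonneg_nonneg[OF psd_sum[OF assms(1)] psd_sum[OF assms(2)]]) simp_all
  then show "0 \<le> (\<Sum>i<n. \<Sum>j<n. cnj (c i) * c j * (k (x i) (x j) + k' (x i) (x j)))"
    by (simp add: distrib_left sum.distrib)
qed

lemma psd_scale:
  assumes "psd_kernel k" "0 \<le> a"
  shows "psd_kernel (\<lambda>z w. a * k z w)"
  unfolding psd_iff
proof (intro allI)
  fix n :: nat and x :: "nat \<Rightarrow> 'a" and c :: "nat \<Rightarrow> complex"
  have "0 \<le> a * (\<Sum>i<n. \<Sum>j<n. cnj (c i) * c j * k (x i) (x j))"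
    by (rule mult_nonneg_nonneg[OF assms(2) psd_sum[OF assms(1)]]) simp
  then show "0 \<le> (\<Sum>i<n. \<Sum>j<n. cnj (c i) * c j * (a * k (x i) (x j)))"
    by (simp only: sum_distrib_left mult_ac)
qed

lemma psd_const:
  assumes "0 \<le> a"
  shows "psd_kernel (\<lambda>z w. a)"
  unfolding psd_iff
proof (intro allI)
  fix n :: nat and x :: "nat \<Rightarrow> 'a" and c :: "nat \<Rightarrow> complex"
  have "(\<Sum>i<n. \<Sum>j<n. cnj (c i) * c j * a) = (\<Sum>i<n. \<Sum>j<n. cnj (c i) * c j) * a"
    by (simp only: sum_distrib_right)
  also have "(\<Sum>i<n. \<Sum>j<n. cnj (c i) * c j) = cnj (\<Sum>i<n. c i) * (\<Sum>i<n. c i)"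
    by (simp only: sum_product cnj_sum)
  also have "\<dots> * a = a * ((\<Sum>i<n. c i) * cnj (\<Sum>i<n. c i))"
    by (simp only: mult_ac)
  also have "(\<Sum>i<n. c i) * cnj (\<Sum>i<n. c i) = complex_of_real ((cmod (\<Sum>i<n. c i))\<^sup>2)"
    by (rule complex_norm_square[symmetric])
  finally have eq: "(\<Sum>i<n. \<Sum>j<n. cnj (c i) * c j * a) = a * complex_of_real ((cmod (\<Sum>i<n. c i))\<^sup>2)" .
  show "0 \<le> (\<Sum>i<n. \<Sum>j<n. cnj (c i) * c j * a)"
    unfolding eq by (intro mult_nonneg_nonneg assms complex_of_real_nonneg) simp
qed

lemma psd_rank_one: "psd_kernel (\<lambda>z w. f z * cnj (f w))"
  using psd_weight[OF psd_const[of 1], of f] by (simp add: less_eq_complex_def)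

lemma psd_finite_sum:
  assumes "\<And>i. i \<in> I \<Longrightarrow> psd_kernel (k i)"
  shows "psd_kernel (\<lambda>z w. \<Sum>i\<in>I. k i z w)"
  using assms
proof (induction I rule: infinite_finite_induct)
  case (insert i I) then show ?case by (simp add: psd_add)
qed (simp_all add: psd_const)

text \<open>The filter is left general because limits of sequences and limits along finite subsets
  both occur below.\<close>

lemma psd_lim:
  fixes K :: "'x \<Rightarrow> 'x \<Rightarrow> complex"
  assumes "\<And>z w. ((\<lambda>t. k t z w) \<longlongrightarrow> K z w) F" "eventually (\<lambda>t. psd_kernel (k t)) F" "F \<noteq> bot"
  shows "psd_kernel K"
  unfolding psd_kernel_def complex_is_Real_iff
proof (intro allI)
  fix n :: nat and x :: "nat \<Rightarrow> 'x" and c :: "nat \<Rightarrow> complex"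
  let ?q = "\<lambda>k. \<Sum>i<n. \<Sum>j<n. cnj (c i) * c j * k (x i) (x j)"
  have lim: "((\<lambda>t. ?q (k t)) \<longlongrightarrow> ?q K) F"
    by (intro tendsto_intros assms(1))
  have ev: "eventually (\<lambda>t. 0 \<le> Re (?q (k t)) \<and> Im (?q (k t)) = 0) F"
    using assms(2) by eventually_elim (simp add: psd_kernel_def complex_is_Real_iff)
  have "0 \<le> Re (?q K)"
    using ev by (intro tendsto_lowerbound[OF tendsto_Re[OF lim] _ assms(3)]) (auto elim: eventually_mono)
  moreover have "((\<lambda>t. Im (?q (k t))) \<longlongrightarrow> 0) F"
    using ev by (intro tendsto_eventually) (auto elim: eventually_mono)
  then have "Im (?q K) = 0"
    using tendsto_unique[OF assms(3) tendsto_Im[OF lim]] by blast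
  ultimately show "Im (?q K) = 0 \<and> 0 \<le> Re (?q K)" by simp
qed

lemma psd_diag:
  assumes "psd_kernel k"
  shows "0 \<le> k z z"
  using psd_sum[OF assms, of "{()}" "\<lambda>_. 1" "\<lambda>_. z"] by simp

lemma psd_diag_Re: "psd_kernel k \<Longrightarrow> 0 \<le> Re (k z z)"
  and psd_diag_of_real: "psd_kernel k \<Longrightarrow> complex_of_real (Re (k z z)) = k z z"
  using psd_diag[of k z] by (auto simp: less_eq_complex_def complex_eq_iff)

text \<open>The form at the two points is real for the coefficients \<open>(1, 1)\<close> and
  \<open>(1, \<i>)\<close>; this compares first the imaginary and then the real parts of the
  off-diagonal values.\<close>

lemma psd_hermitian:
  assumes "psd_kernel k"
  shows "cnj (k z w) = k w z"
proof -
  have *: "Im (k z z) = 0" "Im (k w w) = 0"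
    using psd_diag[OF assms] by (auto simp: less_eq_complex_def)
  have "0 \<le> (\<Sum>i\<in>{True,False}. \<Sum>j\<in>{True,False}. cnj (if i then 1 else t) * (if j then 1 else t)
      * k (if i then z else w) (if j then z else w))" for t
    by (rule psd_sum[OF assms]) simp
  from this[of 1] this[of \<i>] show ?thesis
    using * by (simp add: less_eq_complex_def complex_eq_iff)
qed

section \<open>Cauchy-Schwarz, Schur complements and Schur products\<close>

text \<open>This is the Gram kernel of the vectors \<open>k_z\<close> after a multiple of one fixed
  combination of the \<open>k_(y j)\<close> has been subtracted. The real parameter \<open>a\<close>
  stays free so that a degenerate combination can be handled too.\<close>

lemma psd_remove_span:
  fixes m :: nat
  assumes k: "psd_kernel k" and "a \<in> \<real>"
    and F: "\<And>z. F z = (\<Sum>j<m. d j * k z (y j))"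
  shows "psd_kernel (\<lambda>z w. k z w - 2 * a * (F z * cnj (F w)) + a\<^sup>2 * (F z * cnj (F w)) *
           (\<Sum>i<m. \<Sum>j<m. cnj (d i) * d j * k (y i) (y j)))"
proof -
  have a: "cnj a = a" using assms(2) by (simp add: Reals_cnj_iff)
  \<comment> \<open>The index \<open>None\<close> stands for the running point \<open>z\<close>, and
    \<open>Some j\<close> for the fixed point \<open>y j\<close>.\<close>
  define A where "A i z = (case i of None \<Rightarrow> 1 | Some j \<Rightarrow> - a * F z * cnj (d j))" for i z
  define p where "p i z = (case i of None \<Rightarrow> z | Some j \<Rightarrow> y j)" for i z
  have F': "cnj (F z) = (\<Sum>j<m. cnj (d j) * k (y j) z)" for z
    by (simp add: F psd_hermitian[OF k])
  have "psd_kernel (\<lambda>z w. \<Sum>i\<in>insert None (Some ` {..<m}). \<Sum>j\<in>insert None (Some ` {..<m}).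
           A i z * cnj (A j w) * k (p i z) (p j w))"
    by (rule psd_combine[OF k]) simp
  also have "(\<lambda>z w. \<Sum>i\<in>insert None (Some ` {..<m}). \<Sum>j\<in>insert None (Some ` {..<m}).
           A i z * cnj (A j w) * k (p i z) (p j w)) =
     (\<lambda>z w. k z w - a * cnj (F w) * (\<Sum>j<m. d j * k z (y j)) - a * F z * (\<Sum>j<m. cnj (d j) * k (y j) w)
       + a\<^sup>2 * (F z * cnj (F w)) * (\<Sum>i<m. \<Sum>j<m. cnj (d i) * d j * k (y i) (y j)))"
    by (simp add: A_def p_def a sum.reindex sum.distrib sum_distrib_left sum_negf sum_subtractf power2_eq_square
        algebra_simps)
  finally show ?thesis
    unfolding F[symmetric] F'[symmetric] by (simp add: mult_ac)
qed

text \<open>\<open>F\<close> is a combination of kernel functions and \<open>Q\<close> its squared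
  norm. For \<open>Q \<noteq> 0\<close> the choice \<open>a = 1/Q\<close> in
  \<open>psd_remove_span\<close> gives the claim divided by \<open>Q\<close>; for
  \<open>Q = 0\<close> letting \<open>a\<close> be large forces \<open>F\<close> to vanish.\<close>

lemma psd_cauchy_schwarz:
  fixes m :: nat
  assumes k: "psd_kernel k"
    and F: "\<And>z. F z = (\<Sum>j<m. d j * k z (y j))"
    and Q: "Q = (\<Sum>i<m. \<Sum>j<m. cnj (d i) * d j * k (y i) (y j))"
  shows "psd_kernel (\<lambda>z w. Q * k z w - F z * cnj (F w))"
proof (cases "Q = 0")
  case True
  have "F z = 0" for z
  proof (rule ccontr)
    assume F0: "F z \<noteq> 0"
    \<comment> \<open>Chosen to push the diagonal value at \<open>z\<close> down to -1.\<close>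
    define t where "t = (Re (k z z) + 1) / (2 * (cmod (F z))\<^sup>2)"
    have "psd_kernel (\<lambda>z w. k z w - 2 * of_real t * (F z * cnj (F w)))"
      using psd_remove_span[OF k _ F, of "of_real t"] by (simp add: Q[symmetric] True)
    then have "0 \<le> Re (k z z - 2 * of_real t * (F z * cnj (F z)))"
      by (rule psd_diag_Re)
    also have "\<dots> = Re (k z z) - 2 * t * (cmod (F z))\<^sup>2"
      unfolding complex_norm_square[symmetric] by simp
    also have "\<dots> = -1" using F0 by (simp add: t_def field_simps)
    finally show False by simp
  qed
  then show ?thesis by (simp add: True psd_const)
next
  case False
  have Q0: "0 \<le> Q" unfolding Q using psd_sum[OF k, of "{..<m}" d y] by simp
  then have "Q \<in> \<real>" by (rule nonnegative_complex_is_real)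
  then have "psd_kernel (\<lambda>z w. Q * (k z w - 2 * (1/Q) * (F z * cnj (F w)) + (1/Q)\<^sup>2 * (F z * cnj (F w)) * Q))"
    using psd_scale[OF psd_remove_span[OF k _ F, of "1/Q"] Q0] by (simp add: Q[symmetric])
  also have "(\<lambda>z w. Q * (k z w - 2 * (1/Q) * (F z * cnj (F w)) + (1/Q)\<^sup>2 * (F z * cnj (F w)) * Q))
      = (\<lambda>z w. Q * k z w - F z * cnj (F w))"
    using False by (simp add: fun_eq_iff field_simps power2_eq_square)
  finally show ?thesis .
qed

lemma psd_schur_complement:
  assumes "psd_kernel k"
  shows "psd_kernel (\<lambda>z w. k y y * k z w - k z y * k y w)"
  using psd_cauchy_schwarz[OF assms, where F = "\<lambda>z. k z y" and m = 1 and d = "\<lambda>_. 1" and y = "\<lambda>_. y"]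
  by (simp add: psd_hermitian[OF assms])

text \<open>Cholesky factorization, eliminating one point \<open>a\<close> at a time. The factors
  obtained on \<open>S\<close> are set to zero at \<open>a\<close>, where the remaining kernel
  vanishes.\<close>

lemma psd_finite_decomposition:
  assumes "finite S" "psd_kernel k"
  shows "\<exists>V :: ('a \<Rightarrow> complex) list. \<forall>z\<in>S. \<forall>w\<in>S. k z w = (\<Sum>v\<leftarrow>V. v z * cnj (v w))"
  using assms
proof (induction S arbitrary: k rule: finite_induct)
  case (insert a S)
  have herm: "cnj (k z w) = k w z" for z w using insert.prems by (rule psd_hermitian)
  show ?case
  proof (cases "k a a = 0")
    case True
    \<comment> \<open>With a zero pivot the Schur complement is minus a rank-one kernel, and a
      nonnegative diagonal then leaves only zero.\<close>
    have 0: "k z a = 0" for z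
    proof -
      have "psd_kernel (\<lambda>z w. - (k z a * k a w))"
        using psd_schur_complement[OF insert.prems, of a] True by simp
      from psd_diag[OF this, of z] have "0 \<le> - ((cmod (k z a))\<^sup>2)"
        by (simp add: herm[of z a, symmetric] complex_norm_square[symmetric] less_eq_complex_def del: of_real_power)
      then show ?thesis by simp
    qed
    obtain V where V: "\<forall>z\<in>S. \<forall>w\<in>S. k z w = (\<Sum>v\<leftarrow>V. v z * cnj (v w))"
      using insert by blast
    let ?V = "map (\<lambda>v z. if z = a then 0 else v z) V"
    have "k z w = (\<Sum>v\<leftarrow>?V. v z * cnj (v w))" if "z \<in> insert a S" "w \<in> insert a S" for z w
      using that V 0 herm[of w a] by (cases "z = a"; cases "w = a") (auto simp: o_def)
    then show ?thesis by blast
  next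
    case False
    define r where "r = sqrt (Re (k a a))"
    have r: "complex_of_real (r\<^sup>2) = k a a" "r \<noteq> 0"
      using psd_diag[OF insert.prems, of a] False
      by (auto simp: r_def less_eq_complex_def complex_eq_iff)
    have aa: "0 \<le> 1 / k a a"
      using psd_diag[OF insert.prems, of a] by (simp add: r(1)[symmetric] less_eq_complex_def del: of_real_power)
    define K where "K z w = k z w - k z a * k a w / k a a" for z w
    have "K z w = 1 / k a a * (k a a * k z w - k z a * k a w)" for z w
      using False by (simp add: K_def field_simps)
    then have "psd_kernel K"
      using psd_scale[OF psd_schur_complement[OF insert.prems, of a] aa] by presburger
    then obtain V where V: "\<forall>z\<in>S. \<forall>w\<in>S. K z w = (\<Sum>v\<leftarrow>V. v z * cnj (v w))"
      using insert.IH by blast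
    let ?V = "(\<lambda>z. k z a / of_real r) # map (\<lambda>v z. if z = a then 0 else v z) V"
    have "k z w = (\<Sum>v\<leftarrow>?V. v z * cnj (v w))" if "z \<in> insert a S" "w \<in> insert a S" for z w
    proof -
      have "k z w = K z w + k z a / of_real r * cnj (k w a / of_real r)"
        using r by (simp add: K_def herm power2_eq_square)
      moreover have "K z w = 0" if "z = a \<or> w = a" using that False by (auto simp: K_def)
      ultimately show ?thesis using that V by (cases "z = a"; cases "w = a") (auto simp: o_def)
    qed
    then show ?thesis by blast
  qed
qed auto

text \<open>Schur's product theorem: on a finite set one factor is a sum of rank-one kernels, and
  multiplication by a rank-one kernel merely changes the coefficients in the form of the other
  factor.\<close>

lemma psd_mult:
  assumes "psd_kernel k" "psd_kernel k'"
  shows "psd_kernel (\<lambda>z w. k z w * k' z w)"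
proof (rule psdI_finite)
  fix S :: "'a set" and c :: "'a \<Rightarrow> complex" assume S: "finite S"
  obtain V where V: "\<forall>z\<in>S. \<forall>w\<in>S. k z w = (\<Sum>v\<leftarrow>V. v z * cnj (v w))"
    using psd_finite_decomposition[OF S assms(1)] by blast
  have "0 \<le> (\<Sum>v\<leftarrow>V. \<Sum>z\<in>S. \<Sum>w\<in>S. v z * cnj (c z) * (cnj (v w) * c w) * k' z w)"
    using psd_sum[OF assms(2) S, of "\<lambda>z. cnj (v z) * c z" "\<lambda>z. z" for v]
    by (intro sum_list_nonneg) auto
  also have "\<dots> = (\<Sum>z\<in>S. \<Sum>w\<in>S. cnj (c z) * c w * ((\<Sum>v\<leftarrow>V. v z * cnj (v w)) * k' z w))"
    by (induction V) (simp_all add: sum.distrib algebra_simps)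
  also have "\<dots> = (\<Sum>z\<in>S. \<Sum>w\<in>S. cnj (c z) * c w * (k z w * k' z w))"
    using V by simp
  finally show "0 \<le> \<dots>" .
qed

subsection \<open>Reproducing kernel Hilbert spaces\<close>

text \<open>The squared norm of the combination of the \<open>k_(x j)\<close> with coefficients
  \<open>c\<close>. It is kept complex so that positivity is a statement in the complex
  order.\<close>

definition gram :: "('x \<Rightarrow> 'x \<Rightarrow> complex) \<Rightarrow> nat \<Rightarrow> (nat \<Rightarrow> 'x) \<Rightarrow> (nat \<Rightarrow> complex) \<Rightarrow> complex" where
  "gram k n x c = (\<Sum>i<n. \<Sum>j<n. cnj (c i) * c j * k (x i) (x j))"

abbreviation dominated :: "('x \<Rightarrow> 'x \<Rightarrow> complex) \<Rightarrow> real \<Rightarrow> ('x \<Rightarrow> complex) \<Rightarrow> bool" where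
  "dominated k C f \<equiv> psd_kernel (\<lambda>z w. complex_of_real (C\<^sup>2) * k z w - f z * cnj (f w))"

lemma psd_iff_gram: "psd_kernel k \<longleftrightarrow> (\<forall>n x c. 0 \<le> gram k n x c)"
  unfolding psd_iff gram_def ..

lemma gram_nonneg: "psd_kernel k \<Longrightarrow> 0 \<le> gram k n x c"
  unfolding psd_iff_gram by blast

lemma psdI_gram_nat: "(\<And>n c. 0 \<le> gram k n (\<lambda>i. i) c) \<Longrightarrow> psd_kernel k"
  unfolding gram_def by (rule psdI_nat)

lemma gram_Re_nonneg: "psd_kernel k \<Longrightarrow> 0 \<le> Re (gram k n x c)"
  and gram_of_real: "psd_kernel k \<Longrightarrow> complex_of_real (Re (gram k n x c)) = gram k n x c"
  using gram_nonneg[where k = k and n = n and x = x and c = c] by (simp_all add: less_eq_complex_def complex_eq_iff)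

lemma cmod_gram: "psd_kernel k \<Longrightarrow> cmod (gram k n x c) = Re (gram k n x c)"
  using gram_nonneg[where k = k and n = n and x = x and c = c]
  by (simp add: less_eq_complex_def cmod_def)

lemma gram_rank_one:
  "gram (\<lambda>z w. f z * cnj (f w)) n x c = complex_of_real ((cmod (\<Sum>i<n. cnj (c i) * f (x i)))\<^sup>2)"
  unfolding gram_def complex_norm_square cnj_sum sum_product
  by (intro sum.cong refl) simp

lemma gram_diff:
  "gram (\<lambda>z w. a * k z w - k' z w) n x c = a * gram k n x c - gram k' n x c"
  by (simp add: gram_def sum_subtractf sum_distrib_left algebra_simps)

text \<open>The form of the dominated kernel is a difference of two squares. Domination thus says
  that pairing \<open>f\<close> with a kernel combination is bounded by \<open>\<bar>C\<bar>\<close>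
  times the norm of that combination.\<close>

lemma dominated_iff:
  assumes k: "psd_kernel k"
  shows "dominated k C f \<longleftrightarrow>
    (\<forall>n x c. cmod (\<Sum>i<n. cnj (c i) * f (x i)) \<le> \<bar>C\<bar> * sqrt (Re (gram k n x c)))"
proof -
  have "0 \<le> gram (\<lambda>z w. complex_of_real (C\<^sup>2) * k z w - f z * cnj (f w)) n x c \<longleftrightarrow>
     cmod (\<Sum>i<n. cnj (c i) * f (x i)) \<le> \<bar>C\<bar> * sqrt (Re (gram k n x c))" (is "?l \<longleftrightarrow> ?A \<le> ?B") for n x c
  proof -
    have eq: "gram (\<lambda>z w. complex_of_real (C\<^sup>2) * k z w - f z * cnj (f w)) n x c
        = complex_of_real (?B\<^sup>2 - ?A\<^sup>2)"
      unfolding gram_diff gram_rank_one using gram_Re_nonneg[OF k, where n = n and x = x and c = c] gram_of_real[OF k, where n = n and x = x and c = c]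
      by (simp add: power_mult_distrib)
    have "?l \<longleftrightarrow> ?A\<^sup>2 \<le> ?B\<^sup>2" unfolding eq by (simp add: less_eq_complex_def)
    also have "\<dots> \<longleftrightarrow> ?A \<le> ?B"
      using gram_Re_nonneg[OF k, where n = n and x = x and c = c] by (intro power_mono_iff) auto
    finally show ?thesis .
  qed
  then show ?thesis unfolding psd_iff_gram by simp
qed

lemma in_rkhs_iff: "in_rkhs k f \<longleftrightarrow> (\<exists>C\<ge>0. dominated k C f)"
proof -
  have "\<exists>D\<ge>0. dominated k D f" if "dominated k C f" for C
    using that by (intro exI[of _ "\<bar>C\<bar>"]) (simp only: power2_abs abs_ge_zero simp_thms)
  then show ?thesis unfolding in_rkhs_def by blast
qed

lemma rkhs_norm_nonneg: "in_rkhs k f \<Longrightarrow> 0 \<le> rkhs_norm k f"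
  unfolding rkhs_norm_def in_rkhs_iff by (rule cInf_greatest) auto

lemma rkhs_norm_le: "dominated k C f \<Longrightarrow> 0 \<le> C \<Longrightarrow> rkhs_norm k f \<le> C"
  unfolding rkhs_norm_def by (rule cInf_lower) (auto intro!: bdd_belowI[of _ 0])

text \<open>For a fixed combination every admissible \<open>C\<close> gives the bound, so dividing
  by the norm of the combination lets it pass to the infimum. Consequently the infimum in
  \<open>rkhs_norm\<close> is attained.\<close>

lemma rkhs_bound:
  assumes k: "psd_kernel k" and f: "in_rkhs k f"
  shows "cmod (\<Sum>i<n. cnj (c i) * f (x i)) \<le> rkhs_norm k f * sqrt (Re (gram k n x c))"
proof -
  obtain C where C: "0 \<le> C" "dominated k C f" using f unfolding in_rkhs_iff by blast
  let ?A = "cmod (\<Sum>i<n. cnj (c i) * f (x i))" and ?q = "sqrt (Re (gram k n x c))"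
  have q: "0 \<le> ?q" using gram_Re_nonneg[OF k] by simp
  have A: "?A \<le> \<bar>D\<bar> * ?q" if "dominated k D f" for D
    using that unfolding dominated_iff[OF k] by blast
  show ?thesis
  proof (cases "?q = 0")
    case True then show ?thesis using A[OF C(2)] by simp
  next
    case False
    have "?A / ?q \<le> rkhs_norm k f"
      unfolding rkhs_norm_def
    proof (rule cInf_greatest)
      show "{C. 0 \<le> C \<and> dominated k C f} \<noteq> {}" using C by blast
      show "?A / ?q \<le> D" if "D \<in> {C. 0 \<le> C \<and> dominated k C f}" for D
      proof -
        have "?A \<le> D * ?q" using that A[of D] by auto
        with q False show ?thesis by (simp add: divide_le_eq)
      qed
    qed
    with q False show ?thesis by (simp add: divide_le_eq split: if_splits)
  qed
qed

lemma rkhs_norm_dominated: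
  assumes "psd_kernel k" "in_rkhs k f"
  shows "dominated k (rkhs_norm k f) f"
  using rkhs_bound[OF assms] rkhs_norm_nonneg[OF assms(2)] unfolding dominated_iff[OF assms(1)] by simp

lemma rkhs_lincomb:
  assumes k: "psd_kernel k" and f: "in_rkhs k f" and g: "in_rkhs k g"
  shows "in_rkhs k (\<lambda>z. f z + a * g z)"
    and "rkhs_norm k (\<lambda>z. f z + a * g z) \<le> rkhs_norm k f + cmod a * rkhs_norm k g"
proof -
  let ?C = "rkhs_norm k f + cmod a * rkhs_norm k g"
  have C: "0 \<le> ?C" using rkhs_norm_nonneg[OF f] rkhs_norm_nonneg[OF g] by simp
  have "cmod (\<Sum>i<n. cnj (c i) * (f (x i) + a * g (x i))) \<le> ?C * sqrt (Re (gram k n x c))" for n x c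
  proof -
    have "(\<Sum>i<n. cnj (c i) * (f (x i) + a * g (x i)))
        = (\<Sum>i<n. cnj (c i) * f (x i)) + a * (\<Sum>i<n. cnj (c i) * g (x i))"
      by (simp add: distrib_left sum.distrib sum_distrib_left mult_ac)
    also have "cmod \<dots> \<le> cmod (\<Sum>i<n. cnj (c i) * f (x i)) + cmod a * cmod (\<Sum>i<n. cnj (c i) * g (x i))"
      by (rule norm_triangle_le) (simp add: norm_mult)
    also have "\<dots> \<le> rkhs_norm k f * sqrt (Re (gram k n x c)) + cmod a * (rkhs_norm k g * sqrt (Re (gram k n x c)))"
      by (intro add_mono mult_left_mono rkhs_bound k f g norm_ge_zero)
    finally show ?thesis by (simp only: distrib_right mult.assoc)
  qed
  then have dom: "dominated k ?C (\<lambda>z. f z + a * g z)"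
    unfolding dominated_iff[OF k] using C by simp
  show "in_rkhs k (\<lambda>z. f z + a * g z)"
    unfolding in_rkhs_def using dom by (rule exI)
  show "rkhs_norm k (\<lambda>z. f z + a * g z) \<le> ?C"
    by (rule rkhs_norm_le[OF dom C])
qed

text \<open>Cancels a factor in estimates of a quantity by itself, without asking each time whether
  it vanishes.\<close>

lemma le_if_mult_self_le:
  fixes a b :: real
  assumes "a * a \<le> b * a" "0 \<le> b"
  shows "a \<le> b"
proof (cases "a \<le> 0")
  case True with assms(2) show ?thesis by linarith
next
  case False with assms(1) show ?thesis by (simp add: mult_le_cancel_right_pos)
qed

text \<open>The upper bound on the norm is \<open>psd_cauchy_schwarz\<close>; the lower bound comes
  from pairing the function with its own coefficients.\<close>

lemma kernel_sum:
  assumes k: "psd_kernel k"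
  shows "in_rkhs k (\<lambda>z. \<Sum>j<m. d j * k z (y j))"
    and "rkhs_norm k (\<lambda>z. \<Sum>j<m. d j * k z (y j)) = sqrt (Re (gram k m y d))"
proof -
  let ?f = "\<lambda>z. \<Sum>j<m. d j * k z (y j)" and ?Q = "Re (gram k m y d)"
  have Q: "0 \<le> ?Q" by (rule gram_Re_nonneg[OF k])
  have dom: "dominated k (sqrt ?Q) ?f"
    using psd_cauchy_schwarz[OF k refl, where m = m and d = d and y = y, folded gram_def, OF refl]
      Q gram_of_real[OF k, where n = m and x = y and c = d] by simp
  then show f: "in_rkhs k ?f" unfolding in_rkhs_def by blast
  have "(\<Sum>i<m. cnj (d i) * ?f (y i)) = gram k m y d"
    by (simp add: gram_def sum_distrib_left mult_ac)
  then have eq: "cmod (\<Sum>i<m. cnj (d i) * ?f (y i)) = ?Q"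
    by (simp only: cmod_gram[OF k])
  have "?Q \<le> rkhs_norm k ?f * sqrt ?Q"
    using rkhs_bound[OF k f, where n = m and c = d and x = y] by (simp only: eq)
  then have "sqrt ?Q * sqrt ?Q \<le> rkhs_norm k ?f * sqrt ?Q" using Q by simp
  then have "sqrt ?Q \<le> rkhs_norm k ?f"
    by (rule le_if_mult_self_le) (rule rkhs_norm_nonneg[OF f])
  then show "rkhs_norm k ?f = sqrt ?Q" using rkhs_norm_le[OF dom] Q by simp
qed

lemma kfun_norm_eq: "psd_kernel k \<Longrightarrow> kfun_norm k w = sqrt (Re (k w w))"
  using kernel_sum(2)[of k "\<lambda>_. 1" "\<lambda>_. w" 1] by (simp add: kfun_norm_def gram_def)

section \<open>Multipliers as kernel inequalities\<close>

lemma dominated_mult: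
  assumes M: "psd_kernel (\<lambda>z w. of_real (C\<^sup>2) * l z w - \<phi> z * cnj (\<phi> w) * s z w)" and f: "dominated s A f"
  shows "dominated l (C * A) (\<lambda>z. \<phi> z * f z)"
proof -
  have "psd_kernel (\<lambda>z w. complex_of_real (A\<^sup>2) * (of_real (C\<^sup>2) * l z w - \<phi> z * cnj (\<phi> w) * s z w)
      + \<phi> z * cnj (\<phi> w) * (complex_of_real (A\<^sup>2) * s z w - f z * cnj (f w)))"
    using psd_weight[OF f, of \<phi> "\<lambda>z. z"] psd_scale[OF M complex_of_real_nonneg[OF zero_le_power2]]
    by (intro psd_add) auto
  then show ?thesis by (simp add: algebra_simps power_mult_distrib)
qed

lemma is_multI:
  assumes s: "psd_kernel s" and C: "0 \<le> C"
    and M: "psd_kernel (\<lambda>z w. of_real (C\<^sup>2) * l z w - \<phi> z * cnj (\<phi> w) * s z w)"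
  shows "is_mult s l \<phi>" and "mult_norm s l \<phi> \<le> C"
proof -
  have *: "in_rkhs l (\<lambda>z. \<phi> z * f z) \<and> rkhs_norm l (\<lambda>z. \<phi> z * f z) \<le> C * rkhs_norm s f"
    if f: "in_rkhs s f" for f
  proof -
    have "dominated l (C * rkhs_norm s f) (\<lambda>z. \<phi> z * f z)"
      by (rule dominated_mult[OF M rkhs_norm_dominated[OF s f]])
    then show ?thesis
      unfolding in_rkhs_def using rkhs_norm_le[OF _ mult_nonneg_nonneg[OF C rkhs_norm_nonneg[OF f]]]
      by (intro conjI exI)
  qed
  then show "is_mult s l \<phi>" unfolding is_mult_def by blast
  show "mult_norm s l \<phi> \<le> C"
    unfolding mult_norm_def using * C by (intro cInf_lower) (auto intro!: bdd_belowI[of _ 0])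
qed

text \<open>The adjoint of multiplication by \<open>\<phi>\<close> sends \<open>l_x\<close> to
  \<open>cnj (\<phi> x)\<close> times \<open>s_x\<close>. Testing the multiplier on the adjoint
  image \<open>f\<close> of a combination of the \<open>l_x\<close> bounds the norm of
  \<open>f\<close> by that of the combination.\<close>

lemma is_multD:
  assumes s: "psd_kernel s" and l: "psd_kernel l" and m: "is_mult s l \<phi>"
  obtains C where "0 \<le> C" "psd_kernel (\<lambda>z w. of_real (C\<^sup>2) * l z w - \<phi> z * cnj (\<phi> w) * s z w)"
proof -
  obtain C0 where C0: "\<And>f. in_rkhs s f \<Longrightarrow> in_rkhs l (\<lambda>z. \<phi> z * f z) \<and>
      rkhs_norm l (\<lambda>z. \<phi> z * f z) \<le> C0 * rkhs_norm s f"
    using m unfolding is_mult_def by blast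
  \<comment> \<open>The constant in \<open>is_mult\<close> carries no sign condition, hence the
    absolute value.\<close>
  define C where "C = \<bar>C0\<bar>"
  have C: "in_rkhs l (\<lambda>z. \<phi> z * f z)" "rkhs_norm l (\<lambda>z. \<phi> z * f z) \<le> C * rkhs_norm s f"
    if f: "in_rkhs s f" for f
    using C0[OF f] mult_right_mono[OF abs_ge_self[of C0] rkhs_norm_nonneg[OF f]]
    unfolding C_def by auto
  have "psd_kernel (\<lambda>z w. of_real (C\<^sup>2) * l z w - \<phi> z * cnj (\<phi> w) * s z w)"
    unfolding psd_iff_gram
  proof (intro allI)
    fix n :: nat and x :: "nat \<Rightarrow> 'a" and c :: "nat \<Rightarrow> complex"
    define d where "d j = c j * cnj (\<phi> (x j))" for j
    define f where "f z = (\<Sum>j<n. d j * s z (x j))" for z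
    let ?Q = "Re (gram s n x d)" and ?L = "Re (gram l n x c)"
    have f: "in_rkhs s f" "rkhs_norm s f = sqrt ?Q"
      unfolding f_def by (rule kernel_sum[OF s])+
    have Q: "0 \<le> ?Q" and L: "0 \<le> ?L" by (intro gram_Re_nonneg s l)+
    have "(\<Sum>i<n. cnj (c i) * (\<phi> (x i) * f (x i))) = gram s n x d"
      by (simp add: gram_def f_def d_def sum_distrib_left mult_ac)
    then have "?Q = cmod (\<Sum>i<n. cnj (c i) * (\<phi> (x i) * f (x i)))"
      by (simp only: cmod_gram[OF s])
    also have "\<dots> \<le> rkhs_norm l (\<lambda>z. \<phi> z * f z) * sqrt ?L"
      by (rule rkhs_bound[OF l C(1)[OF f(1)]])
    also have "\<dots> \<le> C * sqrt ?Q * sqrt ?L"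
      using C(2)[OF f(1)] L by (intro mult_right_mono) (auto simp: f(2))
    finally have "sqrt ?Q * sqrt ?Q \<le> C * sqrt ?L * sqrt ?Q" using Q by (simp add: mult_ac)
    then have "sqrt ?Q \<le> C * sqrt ?L"
      by (rule le_if_mult_self_le) (use L in \<open>simp add: C_def\<close>)
    then have "(sqrt ?Q)\<^sup>2 \<le> (C * sqrt ?L)\<^sup>2" using Q by (intro power_mono) auto
    then have QL: "?Q \<le> C\<^sup>2 * ?L" using Q L by (simp add: power_mult_distrib)
    have "gram (\<lambda>z w. of_real (C\<^sup>2) * l z w - \<phi> z * cnj (\<phi> w) * s z w) n x c
        = of_real (C\<^sup>2) * gram l n x c - gram s n x d"
      unfolding gram_diff by (simp add: gram_def d_def mult_ac)
    also have "\<dots> = of_real (C\<^sup>2 * ?L - ?Q)"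
      using gram_of_real[OF s, where n = n and x = x and c = d] gram_of_real[OF l, where n = n and x = x and c = c] by simp
    finally have eq: "gram (\<lambda>z w. of_real (C\<^sup>2) * l z w - \<phi> z * cnj (\<phi> w) * s z w) n x c
        = of_real (C\<^sup>2 * ?L - ?Q)" .
    show "0 \<le> gram (\<lambda>z w. of_real (C\<^sup>2) * l z w - \<phi> z * cnj (\<phi> w) * s z w) n x c"
      unfolding eq using QL by (intro complex_of_real_nonneg) simp
  qed
  then show ?thesis using that[of C] by (simp add: C_def)
qed

subsection \<open>Kernel inequalities for the Carleson and separation conditions\<close>

lemma gram_diagonal:
  "gram (\<lambda>i j. if i = j then complex_of_real (D i) else 0) n (\<lambda>i. i) c
     = complex_of_real (\<Sum>i<n. (cmod (c i))\<^sup>2 * D i)"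
  by (simp add: gram_def if_distrib sum.delta' complex_norm_square[unfolded of_real_power] mult_ac cong: if_cong)

lemma carleson_form:
  assumes s: "psd_kernel s"
  shows "psd_kernel (\<lambda>i j. (if i = j then of_real (C * Re (s (lam i) (lam i))) else 0) - s (lam i) (lam j))
    \<longleftrightarrow> (\<forall>n c. Re (gram s n lam c) \<le> C * (\<Sum>i<n. (cmod (c i))\<^sup>2 * Re (s (lam i) (lam i))))" (is "psd_kernel ?K \<longleftrightarrow> _")
proof -
  let ?n = "\<lambda>i. Re (s (lam i) (lam i))"
  have eq: "gram ?K n (\<lambda>i. i) c = of_real (C * (\<Sum>i<n. (cmod (c i))\<^sup>2 * ?n i) - Re (gram s n lam c))" for n c
  proof -
    have "gram ?K n (\<lambda>i. i) c = gram (\<lambda>i j. if i = j then of_real (C * ?n i) else 0) n (\<lambda>i. i) c - gram s n lam c"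
      using gram_diff[where a = 1 and k = "\<lambda>i j. if i = j then of_real (C * ?n i) else 0"
          and k' = "\<lambda>i j. s (lam i) (lam j)" and n = n and x = "\<lambda>i. i" and c = c]
      by (simp add: gram_def[of "\<lambda>i j. s (lam i) (lam j)"] gram_def[of s])
    also have "\<dots> = of_real (\<Sum>i<n. (cmod (c i))\<^sup>2 * (C * ?n i)) - of_real (Re (gram s n lam c))"
      unfolding gram_diagonal gram_of_real[OF s] ..
    finally show ?thesis by (simp add: sum_distrib_left mult_ac)
  qed
  have le: "0 \<le> gram ?K n (\<lambda>i. i) c \<longleftrightarrow> Re (gram s n lam c) \<le> C * (\<Sum>i<n. (cmod (c i))\<^sup>2 * ?n i)" for n c
    unfolding eq by (simp add: less_eq_complex_def)
  show ?thesis
  proof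
    assume "psd_kernel ?K"
    then show "\<forall>n c. Re (gram s n lam c) \<le> C * (\<Sum>i<n. (cmod (c i))\<^sup>2 * ?n i)"
      unfolding le[symmetric] by (intro allI gram_nonneg)
  next
    assume "\<forall>n c. Re (gram s n lam c) \<le> C * (\<Sum>i<n. (cmod (c i))\<^sup>2 * ?n i)"
    then show "psd_kernel ?K" unfolding le[symmetric] by (intro psdI_gram_nat) blast
  qed
qed

text \<open>The weighted evaluation map from \<open>H_s\<close> into square-summable sequences and
  its adjoint have the same norm; the kernel inequality bounds the adjoint. One direction tests on
  kernel combinations, the other pairs \<open>f\<close> with a combination built from its own
  values.\<close>

lemma carleson_iff:
  assumes s: "psd_kernel s" and pos: "\<And>z. 0 < Re (s z z)"
  shows "carleson s lam \<longleftrightarrow>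
    (\<exists>C>0. psd_kernel (\<lambda>i j. (if i = j then of_real (C * Re (s (lam i) (lam i))) else 0) - s (lam i) (lam j)))"
proof -
  let ?n = "\<lambda>i. Re (s (lam i) (lam i))"
  have nn: "(kfun_norm s (lam i))\<^sup>2 = ?n i" for i
    using pos[of "lam i"] by (simp add: kfun_norm_eq[OF s])
  have "(\<forall>f. in_rkhs s f \<longrightarrow> summable (\<lambda>i. (cmod (f (lam i)))\<^sup>2 / ?n i) \<and>
      (\<Sum>i. (cmod (f (lam i)))\<^sup>2 / ?n i) \<le> C * (rkhs_norm s f)\<^sup>2) \<longleftrightarrow>
     (\<forall>n c. Re (gram s n lam c) \<le> C * (\<Sum>i<n. (cmod (c i))\<^sup>2 * ?n i))" (is "?l \<longleftrightarrow> ?r") if C: "C > 0" for C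
  proof
    assume l: ?l
    show ?r
    proof (intro allI)
      fix n c
      define f where "f z = (\<Sum>j<n. c j * s z (lam j))" for z
      let ?Q = "Re (gram s n lam c)"
      have f: "in_rkhs s f" "rkhs_norm s f = sqrt ?Q"
        unfolding f_def by (rule kernel_sum[OF s])+
      have Q: "0 \<le> ?Q" by (rule gram_Re_nonneg[OF s])
      have "(\<Sum>i<n. cnj (c i) * f (lam i)) = gram s n lam c"
        by (simp add: gram_def f_def sum_distrib_left mult_ac)
      then have "?Q = cmod (\<Sum>i<n. cnj (c i) * f (lam i))"
        by (simp only: cmod_gram[OF s])
      also have "\<dots> \<le> (\<Sum>i<n. (cmod (c i) * sqrt (?n i)) * (cmod (f (lam i)) / sqrt (?n i)))"
        using pos[THEN less_imp_neq] by (intro sum_norm_le) (simp add: norm_mult)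
      finally have "?Q\<^sup>2 \<le> (\<Sum>i<n. (cmod (c i) * sqrt (?n i)) * (cmod (f (lam i)) / sqrt (?n i)))\<^sup>2"
        using Q by (rule power_mono)
      also have "\<dots> \<le> (\<Sum>i<n. (cmod (c i) * sqrt (?n i))\<^sup>2) * (\<Sum>i<n. (cmod (f (lam i)) / sqrt (?n i))\<^sup>2)"
        by (rule Cauchy_Schwarz_ineq_sum)
      also have "\<dots> = (\<Sum>i<n. (cmod (c i))\<^sup>2 * ?n i) * (\<Sum>i<n. (cmod (f (lam i)))\<^sup>2 / ?n i)"
        using pos[THEN less_imp_le] by (simp add: power_mult_distrib power_divide)
      also have "\<dots> \<le> (\<Sum>i<n. (cmod (c i))\<^sup>2 * ?n i) * (C * ?Q)"
      proof (rule mult_left_mono)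
        have "(\<Sum>i<n. (cmod (f (lam i)))\<^sup>2 / ?n i) \<le> (\<Sum>i. (cmod (f (lam i)))\<^sup>2 / ?n i)"
          using l f(1) pos[THEN less_imp_le] by (intro sum_le_suminf) auto
        also have "\<dots> \<le> C * (sqrt ?Q)\<^sup>2" using l f(1) unfolding f(2)[symmetric] by blast
        finally show "(\<Sum>i<n. (cmod (f (lam i)))\<^sup>2 / ?n i) \<le> C * ?Q" using Q by simp
      qed (use pos[THEN less_imp_le] in \<open>auto intro!: sum_nonneg\<close>)
      finally have "?Q * ?Q \<le> (C * (\<Sum>i<n. (cmod (c i))\<^sup>2 * ?n i)) * ?Q"
        by (simp only: power2_eq_square mult_ac)
      moreover have "0 \<le> C * (\<Sum>i<n. (cmod (c i))\<^sup>2 * ?n i)"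
        using C pos[THEN less_imp_le] by (auto intro!: mult_nonneg_nonneg sum_nonneg)
      ultimately show "?Q \<le> C * (\<Sum>i<n. (cmod (c i))\<^sup>2 * ?n i)"
        by (rule le_if_mult_self_le)
    qed
  next
    assume r: ?r
    show ?l
    proof (intro allI impI)
      fix f assume f: "in_rkhs s f"
      let ?A = "rkhs_norm s f"
      have S: "(\<Sum>i<n. (cmod (f (lam i)))\<^sup>2 / ?n i) \<le> C * ?A\<^sup>2" (is "?S \<le> _") for n
      proof -
        \<comment> \<open>With these coefficients the pairing with \<open>f\<close> is exactly the
          partial sum \<open>?S\<close> to be bounded, and so is the weighted sum of the squares of
          \<open>c\<close>.\<close>
        define c where "c i = f (lam i) / of_real (?n i)" for i
        have S0: "0 \<le> ?S" using pos[THEN less_imp_le] by (auto intro!: sum_nonneg)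
        have "(\<Sum>i<n. cnj (c i) * f (lam i)) = of_real ?S"
          by (simp add: c_def complex_norm_square[unfolded of_real_power] mult_ac)
        then have "?S = cmod (\<Sum>i<n. cnj (c i) * f (lam i))"
          by (simp only: norm_of_real abs_of_nonneg[OF S0])
        also have "\<dots> \<le> ?A * sqrt (Re (gram s n lam c))"
          by (rule rkhs_bound[OF s f])
        also have "\<dots> \<le> ?A * sqrt (C * (\<Sum>i<n. (cmod (c i))\<^sup>2 * ?n i))"
          using r rkhs_norm_nonneg[OF f] by (intro mult_left_mono real_sqrt_le_mono) blast+
        also have "(\<Sum>i<n. (cmod (c i))\<^sup>2 * ?n i) = ?S"
          using pos[THEN less_imp_neq] pos[THEN less_imp_le]
          by (intro sum.cong refl) (simp add: c_def norm_divide power_divide power2_eq_square)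
        finally have "?S\<^sup>2 \<le> (?A * sqrt (C * ?S))\<^sup>2" using S0 by (rule power_mono)
        also have "\<dots> = (C * ?A\<^sup>2) * ?S" using S0 C by (simp add: power_mult_distrib)
        finally have "?S * ?S \<le> (C * ?A\<^sup>2) * ?S" by (simp only: power2_eq_square)
        then show ?thesis by (rule le_if_mult_self_le) (use C in simp)
      qed
      have summ: "summable (\<lambda>i. (cmod (f (lam i)))\<^sup>2 / ?n i)"
        by (rule summableI_nonneg_bounded[OF _ S]) (simp add: pos[THEN less_imp_le])
      with S show "summable (\<lambda>i. (cmod (f (lam i)))\<^sup>2 / ?n i) \<and> (\<Sum>i. (cmod (f (lam i)))\<^sup>2 / ?n i) \<le> C * ?A\<^sup>2"
        by (intro conjI suminf_le_const)
    qed
  qed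
  then show ?thesis unfolding carleson_def nn carleson_form[OF s] by blast
qed

text \<open>Dividing a combination by \<open>c i\<close> and the norm of \<open>l_(lam i)\<close>
  turns it into the normalized kernel at \<open>lam i\<close> minus an element of the span of the
  others. The triangle inequality carries the estimate from the span to its closure.\<close>

lemma strongly_separated_iff:
  assumes l: "psd_kernel l" and pos: "\<And>z. 0 < Re (l z z)"
  shows "strongly_separated l lam \<longleftrightarrow>
    (\<exists>\<epsilon>>0. \<forall>i n c. i < n \<longrightarrow> \<epsilon>\<^sup>2 * (cmod (c i))\<^sup>2 * Re (l (lam i) (lam i)) \<le> Re (gram l n lam c))"
proof -
  let ?N = "\<lambda>i. kfun_norm l (lam i)"
  let ?h = "\<lambda>i. kfun_hat l (lam i)"
  let ?S = "\<lambda>i. rkhs_closed_span l ?h {j. j \<noteq> i}"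
  have N: "?N i = sqrt (Re (l (lam i) (lam i)))" "?N i > 0" for i
    using pos by (simp_all add: kfun_norm_eq[OF l])
  have zero: "rkhs_norm l (\<lambda>z. 0) = 0" "in_rkhs l (\<lambda>z. 0)"
    using kernel_sum(2)[OF l, where m = 0] kernel_sum(1)[OF l, where m = 0] by (simp_all add: gram_def)
  have span: "g \<in> ?S i" if "g \<in> fspan ?h {j. j \<noteq> i}" "in_rkhs l g" for g i
    using that by (auto simp: rkhs_closed_span_def zero intro!: bexI[of _ g])
  \<comment> \<open>The distance is a real infimum, for which a lower bound can be inferred only
    over a nonempty set.\<close>
  have ne: "?S i \<noteq> {}" for i
  proof -
    have "(\<lambda>z. 0) \<in> fspan ?h {j. j \<noteq> i}"
      unfolding fspan_def by (rule CollectI, intro exI[of _ "{}"] exI) simp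
    then show ?thesis using span zero(2) by blast
  qed
  have form: "(\<lambda>z. ?h i z - (\<Sum>j\<in>F. a j * ?h j z)) =
      (\<lambda>z. \<Sum>p<n. (if p = i then 1 else if p \<in> F then - a p else 0) / ?N p * l z (lam p))"
    if "F \<subseteq> {..<n}" "i \<notin> F" "i < n" for i n F a
  proof
    fix z
    have "(\<Sum>p<n. (if p = i then 1 else if p \<in> F then - a p else 0) / ?N p * l z (lam p))
        = (\<Sum>p\<in>insert i F. (if p = i then 1 else if p \<in> F then - a p else 0) / ?N p * l z (lam p))"
      using that by (intro sum.mono_neutral_right) auto
    also have "\<dots> = ?h i z - (\<Sum>j\<in>F. a j * ?h j z)"
    proof -
      have "finite F" using that(1) finite_subset by blast
      moreover have "(\<Sum>p\<in>F. (if p = i then 1 else if p \<in> F then - a p else 0) / ?N p * l z (lam p))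
          = (\<Sum>p\<in>F. - (a p * ?h p z))"
        using that(2) by (intro sum.cong refl) (auto simp: kfun_hat_def)
      ultimately show ?thesis using that(2) by (simp add: kfun_hat_def sum_negf)
    qed
    finally show "?h i z - (\<Sum>j\<in>F. a j * ?h j z) =
      (\<Sum>p<n. (if p = i then 1 else if p \<in> F then - a p else 0) / ?N p * l z (lam p))" by (rule sym)
  qed
  have "(\<forall>i. rkhs_dist l (?h i) (?S i) \<ge> \<epsilon>) \<longleftrightarrow>
    (\<forall>i n c. i < n \<longrightarrow> \<epsilon>\<^sup>2 * (cmod (c i))\<^sup>2 * Re (l (lam i) (lam i)) \<le> Re (gram l n lam c))" (is "?l \<longleftrightarrow> ?r")
    if \<epsilon>: "\<epsilon> > 0" for \<epsilon> :: real
  proof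
    assume r: ?r
    show ?l
    proof
      fix i
      have hi: "in_rkhs l (?h i)"
        using kernel_sum(1)[OF l, where m = 1 and y = "\<lambda>_. lam i" and d = "\<lambda>_. 1 / ?N i"]
        by (simp add: kfun_hat_def)
      have g: "in_rkhs l g" "\<epsilon> \<le> rkhs_norm l (\<lambda>z. ?h i z - g z)" if gs: "g \<in> fspan ?h {j. j \<noteq> i}" for g
      proof -
        obtain F a where F: "g = (\<lambda>z. \<Sum>j\<in>F. a j * ?h j z)" "finite F" "i \<notin> F"
          using gs unfolding fspan_def by blast
        obtain n where n: "insert i F \<subseteq> {..<n}"
          using F(2) finite_nat_iff_bounded finite.insertI by meson
        define d where "d p = (if p = i then 1 else if p \<in> F then - a p else 0) / complex_of_real (?N p)" for p
        have eq: "(\<lambda>z. ?h i z - g z) = (\<lambda>z. \<Sum>p<n. d p * l z (lam p))"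
          using form[of F n i a] n F(3) unfolding F(1) d_def by auto
        have "\<epsilon>\<^sup>2 * (cmod (d i))\<^sup>2 * Re (l (lam i) (lam i)) \<le> Re (gram l n lam d)"
          using r n by blast
        moreover have "(cmod (d i))\<^sup>2 * Re (l (lam i) (lam i)) = 1"
          using N[of i] pos[of "lam i"] by (simp add: d_def norm_divide power_divide)
        ultimately have "\<epsilon>\<^sup>2 \<le> Re (gram l n lam d)" by (simp add: mult.assoc)
        then have "sqrt (\<epsilon>\<^sup>2) \<le> sqrt (Re (gram l n lam d))" by (rule real_sqrt_le_mono)
        then show "\<epsilon> \<le> rkhs_norm l (\<lambda>z. ?h i z - g z)"
          unfolding eq kernel_sum(2)[OF l] using \<epsilon> by simp
        have g': "g = (\<lambda>z. ?h i z + (-1) * (\<Sum>p<n. d p * l z (lam p)))"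
          unfolding eq[symmetric, THEN fun_cong] by (simp add: fun_eq_iff)
        show "in_rkhs l g"
          by (subst g') (rule rkhs_lincomb(1)[OF l hi kernel_sum(1)[OF l]])
      qed
      have "\<epsilon> \<le> rkhs_norm l (\<lambda>z. ?h i z - h z)" if hS: "h \<in> ?S i" for h
      proof (rule field_le_epsilon)
        fix \<delta> :: real assume "\<delta> > 0"
        then obtain f where f: "f \<in> fspan ?h {j. j \<noteq> i}" "rkhs_norm l (\<lambda>z. h z - f z) < \<delta>" and h: "in_rkhs l h"
          using hS unfolding rkhs_closed_span_def by blast
        have 1: "in_rkhs l (\<lambda>z. ?h i z - h z)"
          using rkhs_lincomb(1)[OF l hi h, of "-1"] by simp
        have 2: "in_rkhs l (\<lambda>z. h z - f z)"
          using rkhs_lincomb(1)[OF l h g(1)[OF f(1)], of "-1"] by simp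
        have "\<epsilon> \<le> rkhs_norm l (\<lambda>z. ?h i z - f z)" by (rule g(2)[OF f(1)])
        also have "\<dots> \<le> rkhs_norm l (\<lambda>z. ?h i z - h z) + rkhs_norm l (\<lambda>z. h z - f z)"
          using rkhs_lincomb(2)[OF l 1 2, of 1] by simp
        finally show "\<epsilon> \<le> rkhs_norm l (\<lambda>z. ?h i z - h z) + \<delta>" using f(2) by simp
      qed
      then show "\<epsilon> \<le> rkhs_dist l (?h i) (?S i)"
        unfolding rkhs_dist_def by (intro cINF_greatest ne)
    qed
  next
    assume dist: ?l
    show ?r
    proof (intro allI impI)
      fix i n :: nat and c :: "nat \<Rightarrow> complex" assume i: "i < n"
      show "\<epsilon>\<^sup>2 * (cmod (c i))\<^sup>2 * Re (l (lam i) (lam i)) \<le> Re (gram l n lam c)"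
      proof (cases "c i = 0")
        case True then show ?thesis using gram_Re_nonneg[OF l] by simp
      next
        case False
        let ?F = "{..<n} - {i}"
        \<comment> \<open>These coefficients make \<open>?h i - g\<close> equal to the given
          combination divided by \<open>c i * ?N i\<close>.\<close>
        define a where "a p = - (c p * ?N p / (c i * ?N i))" for p
        define d where "d p = (if p = i then 1 else if p \<in> ?F then - a p else 0) / complex_of_real (?N p)" for p
        define g where "g z = (\<Sum>j\<in>?F. a j * ?h j z)" for z
        have eq: "(\<lambda>z. ?h i z - g z) = (\<lambda>z. \<Sum>p<n. d p * l z (lam p))"
          using form[of ?F n i a] i unfolding g_def d_def by auto
        have hi: "in_rkhs l (?h i)"
          using kernel_sum(1)[OF l, where m = 1 and y = "\<lambda>_. lam i" and d = "\<lambda>_. 1 / ?N i"]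
          by (simp add: kfun_hat_def)
        have "in_rkhs l (\<lambda>z. ?h i z + (-1) * (?h i z - g z))"
          unfolding fun_cong[OF eq] by (rule rkhs_lincomb(1)[OF l hi kernel_sum(1)[OF l]])
        then have "g \<in> ?S i"
          by (intro span) (auto simp: fspan_def g_def[abs_def])
        then have "rkhs_dist l (?h i) (?S i) \<le> rkhs_norm l (\<lambda>z. ?h i z - g z)"
          unfolding rkhs_dist_def
        proof (rule cINF_lower[rotated])
          have "in_rkhs l (\<lambda>z. ?h i z - h z)" if "h \<in> ?S i" for h
            using rkhs_lincomb(1)[OF l hi, of h "-1"] that by (simp add: rkhs_closed_span_def)
          then show "bdd_below ((\<lambda>h. rkhs_norm l (\<lambda>z. ?h i z - h z)) ` ?S i)"
            by (intro bdd_belowI2[of _ 0]) (rule rkhs_norm_nonneg)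
        qed
        then have "\<epsilon> \<le> sqrt (Re (gram l n lam d))"
          using dist unfolding eq kernel_sum(2)[OF l] by (meson order.trans)
        then have "\<epsilon>\<^sup>2 \<le> (sqrt (Re (gram l n lam d)))\<^sup>2" using \<epsilon> by (intro power_mono) auto
        then have "\<epsilon>\<^sup>2 \<le> Re (gram l n lam d)" using gram_Re_nonneg[OF l] by simp
        also have "gram l n lam d = complex_of_real (1 / ((cmod (c i))\<^sup>2 * Re (l (lam i) (lam i)))) * gram l n lam c"
        proof -
          have "d p = c p / (c i * ?N i)" if "p < n" for p
            using N(2)[of i] N(2)[of p] False that by (auto simp: d_def a_def field_simps power2_eq_square)
          moreover have "cnj (c i * ?N i) * (c i * ?N i) = complex_of_real ((cmod (c i))\<^sup>2 * Re (l (lam i) (lam i)))"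
            using pos[of "lam i"] unfolding N(1) of_real_mult complex_norm_square
            by (simp add: mult_ac flip: of_real_mult)
          ultimately show ?thesis
            by (simp add: gram_def sum_distrib_left sum_divide_distrib mult_ac flip: of_real_mult)
        qed
        finally show ?thesis using False pos[of "lam i"] by (simp add: field_simps)
      qed
    qed
  qed
  then show ?thesis unfolding strongly_separated_def by blast
qed

subsection \<open>Complete Pick kernels\<close>

lemma psd_cauchy_schwarz_points:
  assumes "psd_kernel k"
  shows "(cmod (k z w))\<^sup>2 \<le> Re (k z z) * Re (k w w)"
proof -
  have "0 \<le> Re (k w w * k z z - k z w * k w z)"
    by (rule psd_diag_Re[OF psd_schur_complement[OF assms]])
  also have "k z w * k w z = of_real ((cmod (k z w))\<^sup>2)"
    unfolding complex_norm_square psd_hermitian[OF assms] ..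
  finally show ?thesis
    using psd_diag[OF assms, of z] by (simp add: less_eq_complex_def mult.commute)
qed

lemma psd_power: "psd_kernel k \<Longrightarrow> psd_kernel (\<lambda>z w. k z w ^ n)"
  by (induction n) (simp_all add: psd_const less_eq_complex_def psd_mult)

lemma psd_increment:
  assumes "psd_kernel k"
  shows "psd_kernel (\<lambda>z w. k z w - k z a - k a w + k a a)"
  using psd_combine[OF assms, of UNIV "\<lambda>i z. if i then 1 else -1" "\<lambda>i z. if i then z else a"]
  by (simp add: UNIV_bool algebra_simps)

text \<open>The product \<open>(1 - 3/4 x) (1 + 3 x)\<close> is \<open>1 + 9/4 x (1 - x)\<close>.
  The exponential form turns a product of losses into the exponential of a sum.\<close>

lemma exp_le_one_minus:
  fixes x :: real
  assumes "0 \<le> x" "x \<le> 1"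
  shows "exp (-3 * x) \<le> 1 - 3/4 * x"
proof -
  have "1 \<le> (1 - 3/4 * x) * (1 + 3 * x)"
    using mult_nonneg_nonneg[OF assms(1), of "1 - x"] assms(2) by (simp add: algebra_simps)
  also have "\<dots> \<le> (1 - 3/4 * x) * exp (3 * x)"
    using assms by (intro mult_left_mono exp_ge_add_one_self) auto
  finally show ?thesis by (simp add: exp_minus field_simps)
qed

text \<open>The inner products of the vectors \<open>b z\<close> enter as a kernel
  \<open>\<beta>\<close>, so the theory can be instantiated again on \<open>X \<times> nat\<close>
  by pulling \<open>\<beta>\<close> back.\<close>

locale pick_kernel =
  fixes \<beta> s :: "'x \<Rightarrow> 'x \<Rightarrow> complex"
  assumes psd_\<beta>: "psd_kernel \<beta>"
    and \<beta>_less: "Re (\<beta> z z) < 1"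
    and s_eq: "s z w = 1 / (1 - \<beta> z w)"
begin

lemma cmod_\<beta>: "cmod (\<beta> z w) < 1"
proof -
  have "(cmod (\<beta> z w))\<^sup>2 \<le> Re (\<beta> z z) * Re (\<beta> w w)"
    by (rule psd_cauchy_schwarz_points[OF psd_\<beta>])
  also have "\<dots> \<le> Re (\<beta> z z)"
    using psd_diag_Re[OF psd_\<beta>, of z] \<beta>_less[of w] by (intro mult_right_le_one_le) (auto intro: psd_diag_Re[OF psd_\<beta>])
  also have "\<dots> < 1\<^sup>2" using \<beta>_less by simp
  finally show ?thesis by (rule power2_less_imp_less) simp
qed

lemma one_minus_\<beta>: "1 - \<beta> z w \<noteq> 0"
  using cmod_\<beta>[of z w] by auto

text \<open>The geometric series in \<open>\<beta>\<close> has positive terms by Schur's product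
  theorem.\<close>

lemma psd_s: "psd_kernel s"
proof (rule psd_lim)
  show "((\<lambda>m. \<Sum>n<m. \<beta> z w ^ n) \<longlongrightarrow> s z w) sequentially" for z w
    using geometric_sums[OF cmod_\<beta>[of z w]] unfolding s_eq sums_def .
qed (simp_all add: psd_finite_sum psd_power psd_\<beta>)

lemma s_diag: "1 \<le> Re (s z z)"
proof -
  have "s z z = of_real (1 / (1 - Re (\<beta> z z)))"
    unfolding s_eq by (simp add: psd_diag_of_real[OF psd_\<beta>])
  then show ?thesis using \<beta>_less[of z] psd_diag_Re[OF psd_\<beta>, of z] by simp
qed

lemma s_nonzero: "s z w \<noteq> 0"
  using one_minus_\<beta> by (simp add: s_eq)

section \<open>Positive kernels summing to at most 1 and concentrated at given points\<close>

definition tf :: "'x \<Rightarrow> 'x \<Rightarrow> complex" where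
  "tf a z = s z a / s a a"

text \<open>\<open>1 - mu a\<close> dominates the positive kernel \<open>tf a tf a\<^sup>* / 4\<close> (in the order \<open>\<preceq>\<close>), yet on the diagonal it
  is at most \<open>3/4 \<cdot> overlap y a\<close> at the points \<open>y\<close> with \<open>s(y, y) \<le> s(a, a)\<close>.\<close>

definition mu :: "'x \<Rightarrow> 'x \<Rightarrow> 'x \<Rightarrow> complex" where
  "mu a z w = 1 - s z a * s a w / (2 * s a a * s z w) - tf a z * cnj (tf a w) / 4"

lemma cnj_tf: "cnj (tf a w) = s a w / s a a"
  by (simp add: tf_def psd_hermitian[OF psd_s])

text \<open>Writes \<open>mu a\<close> as a rank-one kernel plus a weighted Gram kernel of the
  differences \<open>\<beta>_z - \<beta>_a\<close>, so that its positivity can be read off.\<close>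

lemma mu_identity:
  "mu a z w = (2 - tf a z) * cnj (2 - tf a w) / 4 +
     (1 - \<beta> a a) / 2 * (s z a * cnj (s w a) * (\<beta> z w - \<beta> z a - \<beta> a w + \<beta> a a))"
proof -
  \<comment> \<open>The two premises are the relation \<open>s (1 - \<beta>) = 1\<close> at
    \<open>(z, a)\<close> and \<open>(a, w)\<close>. They yield
    \<open>u v (2 - x - y) = u + v\<close>, and this cancels the remainder of the expansion.\<close>
  have "4 - 2 * (1 - q) * (1 - r) * (u * v) - (1 - q) * u * ((1 - q) * v)
     = (2 - (1 - q) * u) * (2 - (1 - q) * v) + 2 * (1 - q) * (u * v * (r - x - y + q))"
    if "u * (1 - x) = 1" "v * (1 - y) = 1" for x y q r u v :: complex
  proof -
    have "u * v * (2 - x - y) = v * (u * (1 - x)) + u * (v * (1 - y))"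
      by (simp add: algebra_simps)
    then have uv: "u * v * (2 - x - y) = u + v" by (simp add: that add.commute)
    have "(2 - (1 - q) * u) * (2 - (1 - q) * v) + 2 * (1 - q) * (u * v * (r - x - y + q)) =
      4 - 2 * (1 - q) * (1 - r) * (u * v) - (1 - q) * u * ((1 - q) * v)
      + 2 * (1 - q) * (u * v * (2 - x - y) - (u + v))"
      by (simp add: algebra_simps)
    then show ?thesis unfolding uv by simp
  qed
  from this[of "s z a" "\<beta> z a" "s a w" "\<beta> a w" "\<beta> a a" "\<beta> z w"]
  have E: "4 - 2 * (1 - \<beta> a a) * (1 - \<beta> z w) * (s z a * s a w) - (1 - \<beta> a a) * s z a * ((1 - \<beta> a a) * s a w)
     = (2 - (1 - \<beta> a a) * s z a) * (2 - (1 - \<beta> a a) * s a w) +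
        2 * (1 - \<beta> a a) * (s z a * s a w * (\<beta> z w - \<beta> z a - \<beta> a w + \<beta> a a))"
    using one_minus_\<beta> by (simp add: s_eq)
  have t: "tf a z = (1 - \<beta> a a) * s z a" "cnj (tf a w) = (1 - \<beta> a a) * s a w"
    unfolding cnj_tf by (simp_all add: tf_def s_eq)
  have "mu a z w = (4 - 2 * (1 - \<beta> a a) * (1 - \<beta> z w) * (s z a * s a w) - tf a z * cnj (tf a w)) / 4"
    unfolding mu_def s_eq[of a a] s_eq[of z w] by (simp add: field_simps)
  also have "\<dots> = ((2 - tf a z) * (2 - cnj (tf a w)) +
        2 * (1 - \<beta> a a) * (s z a * s a w * (\<beta> z w - \<beta> z a - \<beta> a w + \<beta> a a))) / 4"
    unfolding t E ..
  also have "\<dots> = (2 - tf a z) * (2 - cnj (tf a w)) / 4 +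
        (1 - \<beta> a a) / 2 * (s z a * s a w * (\<beta> z w - \<beta> z a - \<beta> a w + \<beta> a a))"
  proof -
    have "(x + 2 * (1 - q) * y) / 4 = x / 4 + (1 - q) / 2 * y" for x y q :: complex
      by (simp add: field_simps)
    then show ?thesis .
  qed
  finally show ?thesis
    unfolding complex_cnj_diff complex_cnj_numeral psd_hermitian[OF psd_s] .
qed

lemma psd_mu: "psd_kernel (mu a)"
proof -
  have "psd_kernel (\<lambda>z w. s z a * cnj (s w a) * (\<beta> z w - \<beta> z a - \<beta> a w + \<beta> a a))"
    using psd_weight[OF psd_increment[OF psd_\<beta>], of "\<lambda>z. s z a" "\<lambda>z. z"] by simp
  moreover have "0 \<le> (1 - \<beta> a a) / 2"
    using \<beta>_less[of a] psd_diag[OF psd_\<beta>, of a] by (simp add: less_eq_complex_def)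
  ultimately have 1: "psd_kernel (\<lambda>z w. (1 - \<beta> a a) / 2 * (s z a * cnj (s w a) * (\<beta> z w - \<beta> z a - \<beta> a w + \<beta> a a)))"
    by (rule psd_scale)
  have "psd_kernel (\<lambda>z w. 1 / 4 * ((2 - tf a z) * cnj (2 - tf a w)))"
    by (rule psd_scale[OF psd_rank_one]) (simp add: less_eq_complex_def)
  from psd_add[OF this 1] show ?thesis unfolding mu_identity[abs_def] by simp
qed

text \<open>Multiplication by \<open>s\<close> cancels the denominator \<open>s z w\<close> in
  \<open>mu\<close> and leaves a positive multiple of the rank-one kernel of
  \<open>s_a\<close>.\<close>

lemma psd_s_times_mu_defect:
  "psd_kernel (\<lambda>z w. s z w * (1 - mu a z w - tf a z * cnj (tf a w) / 4))"
proof -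
  have "s z w * (1 - mu a z w - tf a z * cnj (tf a w) / 4) = 1 / (2 * s a a) * (s z a * cnj (s w a))" for z w
    using s_nonzero by (simp add: mu_def psd_hermitian[OF psd_s])
  moreover have "0 \<le> 1 / (2 * s a a)"
    by (subst psd_diag_of_real[OF psd_s, symmetric]) (use s_diag[of a] in \<open>simp add: less_eq_complex_def\<close>)
  ultimately show ?thesis by (simp only: psd_scale[OF psd_rank_one])
qed

text \<open>The squared modulus of the inner product of the normalized kernels at \<open>y\<close>
  and \<open>a\<close>.\<close>

definition overlap :: "'x \<Rightarrow> 'x \<Rightarrow> real" where
  "overlap y a = (cmod (s y a))\<^sup>2 / (Re (s y y) * Re (s a a))"

lemma overlap_nonneg: "0 \<le> overlap y a"
  using s_diag[of y] s_diag[of a] by (simp add: overlap_def)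

lemma overlap_le_one: "overlap y a \<le> 1"
  using psd_cauchy_schwarz_points[OF psd_s, of y a] s_diag[of y] s_diag[of a]
  by (simp add: overlap_def divide_le_eq)

text \<open>The two subtracted terms of \<open>mu\<close> cost \<open>1/2\<close> and at most
  \<open>1/4\<close> of the overlap; the assumption on the diagonal of \<open>s\<close> is what
  compares the second one with the overlap.\<close>

lemma mu_diag:
  assumes "Re (s y y) \<le> Re (s a a)"
  shows "exp (-3 * overlap y a) \<le> Re (mu a y y)" "mu a y y \<in> \<real>"
proof -
  let ?m = "(cmod (s y a))\<^sup>2" and ?p = "Re (s y y)" and ?q = "Re (s a a)"
  have sa: "s y a * s a y = of_real ?m"
    unfolding complex_norm_square psd_hermitian[OF psd_s] ..
  have pq: "1 \<le> ?p" "1 \<le> ?q" using s_diag by auto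
  have "mu a y y = 1 - s y a * s a y / (2 * s a a * s y y) - (s y a * s a y) / (s a a * s a a) / 4"
    unfolding mu_def cnj_tf by (simp add: tf_def)
  also have "\<dots> = of_real (1 - ?m / (2 * ?q * ?p) - ?m / (?q * ?q) / 4)"
    unfolding sa by (simp add: psd_diag_of_real[OF psd_s])
  finally have mu: "mu a y y = of_real (1 - ?m / (2 * ?q * ?p) - ?m / (?q * ?q) / 4)" .
  then show "mu a y y \<in> \<real>" by simp
  have "?m / (?q * ?q) \<le> ?m / (?p * ?q)"
    using pq assms by (intro divide_left_mono mult_right_mono) auto
  then have "1 - 3/4 * overlap y a \<le> Re (mu a y y)"
    unfolding mu overlap_def by (simp add: mult_ac)
  then show "exp (-3 * overlap y a) \<le> Re (mu a y y)"
    using exp_le_one_minus[OF overlap_nonneg overlap_le_one, of y a] by linarith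
qed

text \<open>Inserting the points in increasing order of \<open>s(a, a)\<close>, multiplying the old kernels by
  \<open>mu a\<close> makes the sum telescope, and \<^term>\<open>mu a\<close> at an old point \<open>y\<close> costs only the summable
  quantity \<open>overlap y a\<close>. This replaces the partition of the sequence into Riesz sequences that the
  solution of the Kadison--Singer problem would provide.\<close>

lemma partition_kernels:
  fixes lam :: "nat \<Rightarrow> 'x"
  assumes "finite J"
  shows "\<exists>\<gamma>. (\<forall>i\<in>J. psd_kernel (\<gamma> i)) \<and> psd_kernel (\<lambda>z w. s z w * (1 - (\<Sum>i\<in>J. \<gamma> i z w))) \<and>
     (\<forall>i\<in>J. 1/4 * exp (-3 * (\<Sum>j\<in>J. overlap (lam i) (lam j))) \<le> Re (\<gamma> i (lam i) (lam i)))"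
  using assms
proof (induction J rule: finite_ranking_induct[where f = "\<lambda>i. Re (s (lam i) (lam i))"])
  case empty
  then show ?case using psd_s by simp
next
  case (insert n J)
  show ?case
  proof (cases "n \<in> J")
    case True then show ?thesis using insert.IH by (simp add: insert_absorb)
  next
    case False
    obtain \<gamma> where \<gamma>: "\<And>i. i \<in> J \<Longrightarrow> psd_kernel (\<gamma> i)"
        "psd_kernel (\<lambda>z w. s z w * (1 - (\<Sum>i\<in>J. \<gamma> i z w)))"
        "\<And>i. i \<in> J \<Longrightarrow> 1/4 * exp (-3 * (\<Sum>j\<in>J. overlap (lam i) (lam j))) \<le> Re (\<gamma> i (lam i) (lam i))"
      using insert.IH by blast
    let ?a = "lam n"
    define \<delta> where "\<delta> i z w = (if i = n then tf ?a z * cnj (tf ?a w) / 4 else mu ?a z w * \<gamma> i z w)" for i z w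
    have tt: "psd_kernel (\<lambda>z w. tf ?a z * cnj (tf ?a w) / 4)"
      using psd_scale[OF psd_rank_one, of "1/4" "tf ?a"] by (simp add: less_eq_complex_def)
    have "\<forall>i\<in>insert n J. psd_kernel (\<delta> i)"
    proof
      fix i assume "i \<in> insert n J"
      then show "psd_kernel (\<delta> i)"
        using tt psd_mult[OF psd_mu \<gamma>(1)] by (cases "i = n") (simp_all add: \<delta>_def[abs_def])
    qed
    moreover have "psd_kernel (\<lambda>z w. s z w * (1 - (\<Sum>i\<in>insert n J. \<delta> i z w)))"
    proof -
      have sum: "(\<Sum>i\<in>insert n J. \<delta> i z w) = tf ?a z * cnj (tf ?a w) / 4 + mu ?a z w * (\<Sum>i\<in>J. \<gamma> i z w)" for z w
      proof -
        have "(\<Sum>i\<in>J. \<delta> i z w) = (\<Sum>i\<in>J. mu ?a z w * \<gamma> i z w)"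
          using False by (intro sum.cong refl) (auto simp: \<delta>_def)
        then show ?thesis using False insert.hyps by (simp add: sum_distrib_left \<delta>_def)
      qed
      \<comment> \<open>The new defect \<open>1 - \<Sum>\<delta>\<close> is
        \<open>(1 - mu - tf tf^*/4) + mu (1 - \<Sum>\<gamma>)\<close>. The first part is positive
        after multiplication by \<open>s\<close>, and the second is the old defect times a positive
        kernel.\<close>
      show ?thesis
        using psd_add[OF psd_s_times_mu_defect[of ?a] psd_mult[OF psd_mu[of ?a] \<gamma>(2)]]
        unfolding sum by (simp add: algebra_simps)
    qed
    moreover have "1/4 * exp (-3 * (\<Sum>j\<in>insert n J. overlap (lam i) (lam j))) \<le> Re (\<delta> i (lam i) (lam i))"
      if i: "i \<in> insert n J" for i
    proof (cases "i = n")
      case True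
      have "Re (\<delta> i (lam i) (lam i)) = 1/4"
        using True s_nonzero by (simp add: \<delta>_def tf_def)
      moreover have "0 \<le> (\<Sum>j\<in>insert n J. overlap (lam i) (lam j))"
        by (intro sum_nonneg overlap_nonneg)
      ultimately show ?thesis by simp
    next
      case False2: False
      then have iJ: "i \<in> J" using i by simp
      have le: "Re (s (lam i) (lam i)) \<le> Re (s ?a ?a)" using insert.hyps(2) iJ by simp
      have "1/4 * exp (-3 * (\<Sum>j\<in>insert n J. overlap (lam i) (lam j)))
          = exp (-3 * overlap (lam i) ?a) * (1/4 * exp (-3 * (\<Sum>j\<in>J. overlap (lam i) (lam j))))"
        using False insert.hyps by (simp add: distrib_left flip: exp_add)
      also have "\<dots> \<le> Re (mu ?a (lam i) (lam i)) * Re (\<gamma> i (lam i) (lam i))"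
        using \<gamma>(3)[OF iJ] mu_diag(1)[OF le] psd_diag_Re[OF psd_mu] by (intro mult_mono) auto
      also have "\<dots> = Re (\<delta> i (lam i) (lam i))"
        using mu_diag(2)[OF le] False2 by (simp add: \<delta>_def complex_is_Real_iff)
      finally show ?thesis .
    qed
    ultimately show ?thesis by blast
  qed
qed

section \<open>Riesz lower bounds from the Carleson and separation conditions\<close>

text \<open>This is the Carleson inequality for the function \<open>s_(lam i)\<close>, divided by
  its squared norm.\<close>

lemma carleson_overlap:
  assumes "carleson s lam"
  obtains C where "\<And>i n. (\<Sum>j<n. overlap (lam i) (lam j)) \<le> C"
proof -
  have N: "(kfun_norm s z)\<^sup>2 = Re (s z z)" for z
    using s_diag[of z] by (simp add: kfun_norm_eq[OF psd_s])
  obtain C where C: "\<And>f. in_rkhs s f \<Longrightarrow> summable (\<lambda>i. (cmod (f (lam i)))\<^sup>2 / Re (s (lam i) (lam i))) \<and>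
      (\<Sum>i. (cmod (f (lam i)))\<^sup>2 / Re (s (lam i) (lam i))) \<le> C * (rkhs_norm s f)\<^sup>2"
    using assms unfolding carleson_def N by blast
  have pos: "0 < Re (s z z)" for z using s_diag[of z] by simp
  show ?thesis
  proof
    fix i n
    let ?y = "lam i"
    have f: "in_rkhs s (\<lambda>z. s z ?y)"
      using kernel_sum(1)[OF psd_s, where m = 1 and d = "\<lambda>_. 1" and y = "\<lambda>_. ?y"] by simp
    have "(\<Sum>j<n. overlap ?y (lam j)) = (\<Sum>j<n. (cmod (s (lam j) ?y))\<^sup>2 / Re (s (lam j) (lam j))) / Re (s ?y ?y)"
      unfolding sum_divide_distrib overlap_def
      by (intro sum.cong refl)
         (metis complex_mod_cnj divide_divide_eq_left' psd_hermitian[OF psd_s])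
    also have "\<dots> \<le> (\<Sum>j. (cmod (s (lam j) ?y))\<^sup>2 / Re (s (lam j) (lam j))) / Re (s ?y ?y)"
      using C[OF f] pos[THEN less_imp_le] by (intro divide_right_mono sum_le_suminf) auto
    also have "\<dots> \<le> C * (kfun_norm s ?y)\<^sup>2 / Re (s ?y ?y)"
      using C[OF f] pos[of ?y] by (intro divide_right_mono) (auto simp: kfun_norm_def)
    also have "\<dots> = C" using pos[of ?y] by (simp add: N)
    finally show "(\<Sum>j<n. overlap ?y (lam j)) \<le> C" .
  qed
qed

text \<open>With \<open>E_i\<close> the one-entry matrix of the separation bound at
  \<open>i\<close>, both \<open>\<Sum> \<gamma>_i (l - E_i)\<close> and
  \<open>l (1 - \<Sum> \<gamma>_i)\<close> are positive. In their sum all products of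
  \<open>\<gamma>_i\<close> with \<open>l\<close> cancel, which leaves \<open>l\<close> minus a
  diagonal matrix.\<close>

lemma riesz_lower:
  assumes g: "psd_kernel g" and l: "\<And>z w. l z w = s z w * g z w"
    and C: "\<And>i n. (\<Sum>j<n. overlap (lam i) (lam j)) \<le> C"
    and sep: "\<And>i n c. i < n \<Longrightarrow> \<epsilon>\<^sup>2 * (cmod (c i))\<^sup>2 * Re (l (lam i) (lam i)) \<le> Re (gram l n lam c)"
  shows "\<epsilon>\<^sup>2 * (1/4 * exp (-3 * C)) * (\<Sum>i<n. (cmod (c i))\<^sup>2 * Re (l (lam i) (lam i))) \<le> Re (gram l n lam c)"
proof -
  have psd_l: "psd_kernel l" using psd_mult[OF psd_s g] by (simp add: l[abs_def])
  let ?L = "\<lambda>i. Re (l (lam i) (lam i))"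
  let ?E = "\<lambda>i p q. if p = i \<and> q = i then complex_of_real (\<epsilon>\<^sup>2 * ?L i) else 0"
  obtain \<gamma> where \<gamma>: "\<And>i. i < n \<Longrightarrow> psd_kernel (\<gamma> i)"
      "psd_kernel (\<lambda>z w. s z w * (1 - (\<Sum>i<n. \<gamma> i z w)))"
      "\<And>i. i < n \<Longrightarrow> 1/4 * exp (-3 * (\<Sum>j<n. overlap (lam i) (lam j))) \<le> Re (\<gamma> i (lam i) (lam i))"
    using partition_kernels[of "{..<n}" lam] by auto
  have E: "gram (?E i) m (\<lambda>i. i) c = complex_of_real (if i < m then \<epsilon>\<^sup>2 * (cmod (c i))\<^sup>2 * ?L i else 0)" for i m c
  proof -
    have "gram (?E i) m (\<lambda>i. i) c = (\<Sum>p<m. if p = i then (\<Sum>q<m. if q = i then cnj (c i) * c i * of_real (\<epsilon>\<^sup>2 * ?L i) else 0) else 0)"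
      unfolding gram_def
    proof (intro sum.cong refl)
      fix p
      show "(\<Sum>q<m. cnj (c p) * c q * ?E i p q)
          = (if p = i then (\<Sum>q<m. if q = i then cnj (c i) * c i * of_real (\<epsilon>\<^sup>2 * ?L i) else 0) else 0)"
        by (cases "p = i") (simp_all add: if_distrib cong: if_cong)
    qed
    then show ?thesis by (simp add: complex_norm_square[unfolded of_real_power] mult_ac)
  qed
  have ll: "gram (\<lambda>p q. l (lam p) (lam q)) m (\<lambda>i. i) c = gram l m lam c" for m c
    by (simp add: gram_def)
  have K: "psd_kernel (\<lambda>p q. 1 * l (lam p) (lam q) - ?E i p q)" for i
  proof (rule psdI_gram_nat)
    fix m c
    have "0 \<le> Re (gram l m lam c) - (if i < m then \<epsilon>\<^sup>2 * (cmod (c i))\<^sup>2 * ?L i else 0)"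
      using sep[of i m c] gram_Re_nonneg[OF psd_l, where n = m and x = lam and c = c] by simp
    then have "0 \<le> complex_of_real (Re (gram l m lam c) - (if i < m then \<epsilon>\<^sup>2 * (cmod (c i))\<^sup>2 * ?L i else 0))"
      by (rule complex_of_real_nonneg)
    then show "0 \<le> gram (\<lambda>p q. 1 * l (lam p) (lam q) - ?E i p q) m (\<lambda>i. i) c"
      unfolding gram_diff E ll by (simp add: gram_of_real[OF psd_l])
  qed
  have 1: "psd_kernel (\<lambda>p q. \<Sum>i<n. \<gamma> i (lam p) (lam q) * (1 * l (lam p) (lam q) - ?E i p q))"
    using psd_weight[OF \<gamma>(1), of _ "\<lambda>_. 1" lam] by (intro psd_finite_sum psd_mult[OF _ K]) simp
  have "psd_kernel (\<lambda>z w. s z w * (1 - (\<Sum>i<n. \<gamma> i z w)) * g z w)"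
    by (rule psd_mult[OF \<gamma>(2) g])
  \<comment> \<open>Here the factorization of \<open>l\<close> enters:
    \<open>s (1 - \<Sum> \<gamma>_i)\<close> is positive, and multiplying by \<open>g\<close>
    produces \<open>l\<close>.\<close>
  then have 2: "psd_kernel (\<lambda>p q. l (lam p) (lam q) * (1 - (\<Sum>i<n. \<gamma> i (lam p) (lam q))))"
    using psd_weight[of _ "\<lambda>_. 1" lam] by (simp add: l mult_ac)
  let ?D = "\<lambda>i. \<epsilon>\<^sup>2 * ?L i * Re (\<gamma> i (lam i) (lam i))"
  let ?K = "\<lambda>p q. (\<Sum>i<n. \<gamma> i (lam p) (lam q) * (1 * l (lam p) (lam q) - ?E i p q)) +
      l (lam p) (lam q) * (1 - (\<Sum>i<n. \<gamma> i (lam p) (lam q)))"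
  have "gram ?K n (\<lambda>i. i) c = gram l n lam c - complex_of_real (\<Sum>i<n. (cmod (c i))\<^sup>2 * ?D i)"
  proof -
    have "?K p q = 1 * l (lam p) (lam q) - (if p = q then complex_of_real (?D p) else 0)" if "p < n" "q < n" for p q
    proof -
      have "?K p q = l (lam p) (lam q) - (\<Sum>i<n. \<gamma> i (lam p) (lam q) * ?E i p q)"
        by (simp add: right_diff_distrib sum_subtractf sum_distrib_left sum_distrib_right mult_ac del: if_split)
      also have "(\<Sum>i<n. \<gamma> i (lam p) (lam q) * ?E i p q)
          = (\<Sum>i<n. if i = p then (if p = q then complex_of_real (?D p) else 0) else 0)"
        using psd_diag_of_real[OF \<gamma>(1)[OF that(1)], of "lam p"]
        by (intro sum.cong refl) auto
      finally show ?thesis using that by simp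
    qed
    then have "gram ?K n (\<lambda>i. i) c = gram (\<lambda>p q. 1 * l (lam p) (lam q) - (if p = q then complex_of_real (?D p) else 0)) n (\<lambda>i. i) c"
      unfolding gram_def by (intro sum.cong refl) simp
    then show ?thesis unfolding gram_diff gram_diagonal ll by simp
  qed
  with gram_nonneg[OF psd_add[OF 1 2], where n = n and x = "\<lambda>i. i" and c = c]
  have "(\<Sum>i<n. (cmod (c i))\<^sup>2 * ?D i) \<le> Re (gram l n lam c)"
    by (simp add: less_eq_complex_def)
  moreover have "\<epsilon>\<^sup>2 * (1/4 * exp (-3 * C)) * (\<Sum>i<n. (cmod (c i))\<^sup>2 * ?L i) \<le> (\<Sum>i<n. (cmod (c i))\<^sup>2 * ?D i)"
    unfolding sum_distrib_left
  proof (rule sum_mono)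
    fix i assume i: "i \<in> {..<n}"
    have "1/4 * exp (-3 * C) \<le> 1/4 * exp (-3 * (\<Sum>j<n. overlap (lam i) (lam j)))"
      using C[of i n] by simp
    also have "\<dots> \<le> Re (\<gamma> i (lam i) (lam i))" using \<gamma>(3) i by simp
    finally have "(\<epsilon>\<^sup>2 * ((cmod (c i))\<^sup>2 * ?L i)) * (1/4 * exp (-3 * C)) \<le> (\<epsilon>\<^sup>2 * ((cmod (c i))\<^sup>2 * ?L i)) * Re (\<gamma> i (lam i) (lam i))"
      using psd_diag_Re[OF psd_l] by (intro mult_left_mono) auto
    then show "\<epsilon>\<^sup>2 * (1/4 * exp (-3 * C)) * ((cmod (c i))\<^sup>2 * ?L i) \<le> (cmod (c i))\<^sup>2 * ?D i"
      by (simp add: mult_ac)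
  qed
  ultimately show ?thesis by linarith
qed

end

text \<open>Finite sums over coordinates of \<open>b\<close> are sums of rank-one kernels, and the
  inner product is their limit along finite subsets.\<close>

lemma ncp_kernel_pick:
  assumes "ncp_kernel b s"
  shows "pick_kernel (\<lambda>z w. \<Sum>\<^sub>\<infinity>j. b z j * cnj (b w j)) s"
proof -
  have b: "(\<lambda>j. (cmod (b z j))\<^sup>2) summable_on UNIV" "(\<Sum>\<^sub>\<infinity>j. (cmod (b z j))\<^sup>2) < 1" for z
    using assms by (auto simp: ncp_kernel_def)
  have summ: "(\<lambda>j. b z j * cnj (b w j)) summable_on UNIV" for z w
  proof (rule abs_summable_summable, rule Infinite_Sum.abs_summable_on_comparison_test')
    show "(\<lambda>j. (cmod (b z j))\<^sup>2 + (cmod (b w j))\<^sup>2) summable_on UNIV"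
      by (intro summable_on_add b)
    show "norm (b z j * cnj (b w j)) \<le> (cmod (b z j))\<^sup>2 + (cmod (b w j))\<^sup>2" for j
    proof -
      have "2 * (cmod (b z j) * cmod (b w j)) \<le> (cmod (b z j))\<^sup>2 + (cmod (b w j))\<^sup>2"
        using sum_squares_bound[of "cmod (b z j)" "cmod (b w j)"] by (simp add: mult_ac)
      moreover have "0 \<le> cmod (b z j) * cmod (b w j)" by simp
      ultimately show ?thesis by (simp only: norm_mult complex_mod_cnj)
    qed
  qed
  show ?thesis
  proof
    show "psd_kernel (\<lambda>z w. \<Sum>\<^sub>\<infinity>j. b z j * cnj (b w j))"
    proof (rule psd_lim)
      show "((\<lambda>F. \<Sum>j\<in>F. b z j * cnj (b w j)) \<longlongrightarrow> (\<Sum>\<^sub>\<infinity>j. b z j * cnj (b w j)))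
          (finite_subsets_at_top UNIV)" for z w
        by (rule infsum_tendsto[OF summ])
      show "\<forall>\<^sub>F F in finite_subsets_at_top UNIV. psd_kernel (\<lambda>z w. \<Sum>j\<in>F. b z j * cnj (b w j))"
        by (intro always_eventually allI psd_finite_sum psd_rank_one)
    qed simp
    show "Re (\<Sum>\<^sub>\<infinity>j. b z j * cnj (b z j)) < 1" for z
    proof -
      have "(\<Sum>\<^sub>\<infinity>j. b z j * cnj (b z j)) = (\<Sum>\<^sub>\<infinity>j. complex_of_real ((cmod (b z j))\<^sup>2))"
        unfolding complex_norm_square ..
      also have "\<dots> = complex_of_real (\<Sum>\<^sub>\<infinity>j. (cmod (b z j))\<^sup>2)"
        by (intro infsumI) (simp only: has_sum_of_real_iff has_sum_infsum[OF b(1)])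
      finally show ?thesis using b(2)[of z] by simp
    qed
    show "s z w = 1 / (1 - (\<Sum>\<^sub>\<infinity>j. b z j * cnj (b w j)))" for z w
      using assms by (simp add: ncp_kernel_def)
  qed
qed

subsection \<open>Leech extension\<close>

lemma square_system_solvable:
  fixes A :: "nat \<Rightarrow> nat \<Rightarrow> complex"
  assumes inj: "\<And>v i. (\<And>j. j < n \<Longrightarrow> (\<Sum>i<n. v i * A i j) = 0) \<Longrightarrow> i < n \<Longrightarrow> v i = 0"
  shows "\<exists>v. \<forall>j<n. (\<Sum>i<n. v i * A i j) = r j"
proof -
  \<comment> \<open>The transpose of \<open>A\<close>, since the matrix acts on the unknown
    \<open>v\<close> as a column.\<close>
  define M where "M = mat n n (\<lambda>(j, i). A i j)"
  have M: "M \<in> carrier_mat n n" by (simp add: M_def)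
  have Mv: "vec_index (M *\<^sub>v v) j = (\<Sum>i<n. vec_index v i * A i j)" if "v \<in> carrier_vec n" "j < n" for v j
    using that by (simp add: M_def scalar_prod_def lessThan_atLeast0 mult.commute)
  have "det M \<noteq> 0"
  proof
    assume "det M = 0"
    then obtain v where v: "v \<in> carrier_vec n" "v \<noteq> 0\<^sub>v n" "M *\<^sub>v v = 0\<^sub>v n"
      unfolding det_0_iff_vec_prod_zero_field[OF M] by blast
    have "vec_index v i = 0" if "i < n" for i
      using inj[of "vec_index v" i] Mv[OF v(1)] that v(3) by (metis index_zero_vec(1))
    then have "v = 0\<^sub>v n" using v(1) by (intro eq_vecI) auto
    with v(2) show False by contradiction
  qed
  from det_non_zero_imp_unit[OF M this, of n]
  obtain B where B: "B \<in> carrier_mat n n" "M * B = 1\<^sub>m n"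
    unfolding Units_def ring_mat_def by auto
  let ?v = "B *\<^sub>v vec n r"
  have v: "?v \<in> carrier_vec n" using B by simp
  have "M *\<^sub>v ?v = vec n r"
    using B M by (simp add: assoc_mult_mat_vec[symmetric])
  then have "(\<Sum>i<n. vec_index ?v i * A i j) = r j" if "j < n" for j
    using Mv[OF v that] that by simp
  then show ?thesis by blast
qed

text \<open>The assumption says that \<open>a\<close> gives the coefficients of the projection of
  \<open>k_z\<close> onto the span of the \<open>k_(y j)\<close>. The result is the Gram kernel of
  the residuals, both cross terms being equal to the last term.\<close>

lemma psd_project:
  fixes n :: nat
  assumes k: "psd_kernel k"
    and a: "\<And>z j. j < n \<Longrightarrow> k z (y j) = (\<Sum>i<n. a i z * k (y i) (y j))"
  shows "psd_kernel (\<lambda>z w. k z w - (\<Sum>i<n. \<Sum>j<n. a i z * cnj (a j w) * k (y i) (y j)))"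
proof -
  define A where "A i z = (case i of None \<Rightarrow> 1 | Some j \<Rightarrow> - a j z)" for i z
  define p where "p i z = (case i of None \<Rightarrow> z | Some j \<Rightarrow> y j)" for i z
  let ?S = "\<lambda>z w. \<Sum>i<n. \<Sum>j<n. a i z * cnj (a j w) * k (y i) (y j)"
  have "psd_kernel (\<lambda>z w. \<Sum>i\<in>insert None (Some ` {..<n}). \<Sum>j\<in>insert None (Some ` {..<n}).
           A i z * cnj (A j w) * k (p i z) (p j w))"
    by (rule psd_combine[OF k]) simp
  moreover have "(\<Sum>i\<in>insert None (Some ` {..<n}). \<Sum>j\<in>insert None (Some ` {..<n}).
           A i z * cnj (A j w) * k (p i z) (p j w)) = k z w - ?S z w" for z w
  proof -
    have l: "(\<Sum>j<n. cnj (a j w) * k z (y j)) = ?S z w"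
    proof -
      have "(\<Sum>j<n. cnj (a j w) * k z (y j)) = (\<Sum>j<n. \<Sum>i<n. a i z * cnj (a j w) * k (y i) (y j))"
        by (intro sum.cong refl) (simp add: a sum_distrib_left mult_ac)
      then show ?thesis using sum.swap by simp
    qed
    have r: "(\<Sum>i<n. a i z * k (y i) w) = ?S z w"
    proof (intro sum.cong refl)
      fix i assume "i \<in> {..<n}"
      then have "k (y i) w = cnj (\<Sum>j<n. a j w * k (y j) (y i))"
        using a[of i w] psd_hermitian[OF k, of w "y i"] by simp
      then show "a i z * k (y i) w = (\<Sum>j<n. a i z * cnj (a j w) * k (y i) (y j))"
        by (simp add: sum_distrib_left psd_hermitian[OF k] mult_ac)
    qed
    have "(\<Sum>i\<in>insert None (Some ` {..<n}). \<Sum>j\<in>insert None (Some ` {..<n}).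
           A i z * cnj (A j w) * k (p i z) (p j w)) =
       k z w - (\<Sum>j<n. cnj (a j w) * k z (y j)) - (\<Sum>i<n. a i z * k (y i) w) + ?S z w"
      by (simp add: A_def p_def sum.reindex sum.distrib sum_negf sum_subtractf)
    then show ?thesis unfolding l r by simp
  qed
  ultimately show ?thesis by simp
qed

text \<open>The positive kernel \<open>h = s (g - \<rho>)\<close> satisfies \<open>g + \<beta> h = \<rho> + h\<close> on the nodes; \<open>h\<close> is extended
  as \<open>a h a\<^sup>*\<close> where \<open>a\<close> solves the linear system that expresses the compression of \<open>g + \<beta> h\<close> to
  the nodes (the lurking isometry argument in coordinates).\<close>

lemma (in pick_kernel) leech_extension:
  fixes y :: "nat \<Rightarrow> 'x" and \<rho> :: "nat \<Rightarrow> nat \<Rightarrow> complex"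
  assumes g: "psd_kernel g" and \<rho>: "psd_kernel \<rho>"
    and \<rho>_pos: "\<And>c i. gram \<rho> n (\<lambda>i. i) c = 0 \<Longrightarrow> i < n \<Longrightarrow> c i = 0"
    and h: "psd_kernel (\<lambda>i j. s (y i) (y j) * (g (y i) (y j) - \<rho> i j))"
  obtains a where "\<And>i j. i < n \<Longrightarrow> j < n \<Longrightarrow> a i (y j) = (if i = j then 1 else 0)"
    "psd_kernel (\<lambda>z w. s z w * (g z w - (\<Sum>i<n. \<Sum>j<n. a i z * cnj (a j w) * \<rho> i j)))"
proof -
  \<comment> \<open>\<open>P\<close> is the common value of \<open>\<rho> + h\<close> and
    \<open>g + \<beta> h\<close> on the nodes.\<close>
  define h where "h i j = s (y i) (y j) * (g (y i) (y j) - \<rho> i j)" for i j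
  define P where "P i j = \<rho> i j + h i j" for i j
  have psd_h: "psd_kernel h" using assms(4) by (simp add: h_def[abs_def])
  have P_eq: "P i j = g (y i) (y j) + \<beta> (y i) (y j) * h i j" for i j
    using one_minus_\<beta>[of "y i" "y j"] by (simp add: P_def h_def s_eq field_simps)
  \<comment> \<open>Let \<open>p\<close> be the form of \<open>P\<close> at a null vector.
    Cauchy-Schwarz for \<open>h\<close> gives \<open>p^2 \<le> \<beta>(z,z) p^2\<close>, hence
    \<open>p = 0\<close> because \<open>\<beta>(z,z) < 1\<close>. The form of \<open>\<rho>\<close>,
    being at most \<open>p\<close>, vanishes as well, and \<open>\<rho>\<close> is strictly positive
    on the nodes.\<close>
  have inj: "v i = 0"
    if v: "\<And>j. j < n \<Longrightarrow> (\<Sum>i<n. v i * (P i j - h i j * \<beta> z (y j))) = 0" and i: "i < n" for v z i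
  proof -
    define c where "c i = cnj (v i)" for i
    define d where "d j = cnj (v j) * \<beta> z (y j)" for j
    define F where "F i = (\<Sum>j<n. d j * h i j)" for i
    let ?id = "\<lambda>i::nat. i"
    let ?p = "Re (gram P n ?id c)" and ?h = "Re (gram h n ?id c)" and ?r = "Re (gram \<rho> n ?id c)"
    let ?Q = "gram h n ?id d"
    have p: "gram P n ?id c = gram \<rho> n ?id c + gram h n ?id c"
      by (simp add: gram_def P_def distrib_left sum.distrib)
    have p2: "gram P n ?id c = gram g n y c + gram (\<lambda>i j. \<beta> (y i) (y j) * h i j) n ?id c"
      by (simp add: gram_def P_eq distrib_left sum.distrib)
    have r0: "0 \<le> ?r" and h0: "0 \<le> ?h" by (intro gram_Re_nonneg \<rho> psd_h)+
    have "gram P n ?id c = (\<Sum>i<n. cnj (c i) * F i)"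
    proof -
      have "gram P n ?id c = (\<Sum>j<n. cnj (v j) * (\<Sum>i<n. v i * P i j))"
        unfolding gram_def c_def by (subst sum.swap) (simp add: sum_distrib_left mult_ac)
      also have "\<dots> = (\<Sum>j<n. cnj (v j) * (\<Sum>i<n. v i * (h i j * \<beta> z (y j))))"
        using v by (intro sum.cong refl) (simp add: right_diff_distrib sum_subtractf)
      also have "\<dots> = (\<Sum>i<n. cnj (c i) * F i)"
        unfolding F_def sum_distrib_left by (subst sum.swap) (simp add: c_def d_def mult_ac)
      finally show ?thesis .
    qed
    then have "(cmod (gram P n ?id c))\<^sup>2 = Re (gram (\<lambda>i j. F i * cnj (F j)) n ?id c)"
      unfolding gram_rank_one by simp
    also have "\<dots> \<le> Re (?Q * gram h n ?id c)"
      using gram_Re_nonneg[OF psd_cauchy_schwarz[OF psd_h F_def gram_def[of h n ?id d]], where n = n and x = ?id and c = c]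
      unfolding gram_diff by simp
    also have "\<dots> = Re ?Q * ?h"
      using gram_nonneg[OF psd_h, where n = n and x = ?id and c = c] by (simp add: less_eq_complex_def)
    also have "\<dots> \<le> (Re (\<beta> z z) * ?p) * ?p"
    proof (rule mult_mono)
      \<comment> \<open>The Schur complement of \<open>\<beta>\<close> at \<open>z\<close>,
        multiplied by \<open>h\<close>, bounds \<open>?Q\<close> by \<open>\<beta> z z\<close> times
        the form of \<open>\<beta> h\<close>.\<close>
      have "psd_kernel (\<lambda>i j. (\<beta> z z * \<beta> (y i) (y j) - \<beta> (y i) z * \<beta> z (y j)) * h i j)"
        using psd_weight[OF psd_schur_complement[OF psd_\<beta>, of z], where f = "\<lambda>_. 1" and p = y] by (intro psd_mult psd_h) simp
      then have "0 \<le> gram (\<lambda>i j. \<beta> z z * (\<beta> (y i) (y j) * h i j) - \<beta> (y i) z * \<beta> z (y j) * h i j) n ?id c"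
        by (intro gram_nonneg) (simp add: algebra_simps)
      also have "gram (\<lambda>i j. \<beta> z z * (\<beta> (y i) (y j) * h i j) - \<beta> (y i) z * \<beta> z (y j) * h i j) n ?id c
          = \<beta> z z * gram (\<lambda>i j. \<beta> (y i) (y j) * h i j) n ?id c - ?Q"
        unfolding gram_diff by (simp add: gram_def c_def d_def psd_hermitian[OF psd_\<beta>] mult_ac)
      finally have "Re ?Q \<le> Re (\<beta> z z * gram (\<lambda>i j. \<beta> (y i) (y j) * h i j) n ?id c)"
        by (simp add: less_eq_complex_def)
      also have "\<dots> = Re (\<beta> z z) * Re (gram (\<lambda>i j. \<beta> (y i) (y j) * h i j) n ?id c)"
        using psd_diag[OF psd_\<beta>, of z] by (simp add: less_eq_complex_def)
      also have "\<dots> \<le> Re (\<beta> z z) * ?p"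
        using gram_Re_nonneg[OF g, where n = n and x = y and c = c] psd_diag_Re[OF psd_\<beta>]
        by (intro mult_left_mono) (auto simp: p2)
      finally show "Re ?Q \<le> Re (\<beta> z z) * ?p" .
      show "?h \<le> ?p" using r0 by (simp add: p)
      show "0 \<le> Re (\<beta> z z) * ?p" using psd_diag_Re[OF psd_\<beta>, of z] r0 h0 by (simp add: p)
    qed (rule h0)
    finally have "(cmod (gram P n ?id c))\<^sup>2 \<le> Re (\<beta> z z) * ?p\<^sup>2"
      by (simp add: power2_eq_square mult_ac)
    moreover have "?p\<^sup>2 \<le> (cmod (gram P n ?id c))\<^sup>2"
      by (rule power_mono[OF complex_Re_le_cmod]) (use r0 h0 in \<open>simp add: p\<close>)
    ultimately have "?p\<^sup>2 \<le> Re (\<beta> z z) * ?p\<^sup>2" by simp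
    then have "(1 - Re (\<beta> z z)) * ?p\<^sup>2 \<le> 0" by (simp add: left_diff_distrib)
    then have "?p = 0" using \<beta>_less[of z] by (simp add: mult_le_0_iff)
    then have "?r = 0" using r0 h0 by (simp add: p)
    then have "gram \<rho> n ?id c = 0"
      using gram_nonneg[OF \<rho>, where n = n and x = ?id and c = c] by (simp add: less_eq_complex_def complex_eq_iff)
    from \<rho>_pos[OF this i] show "v i = 0" by (simp add: c_def)
  qed
  have "\<exists>v. \<forall>j<n. (\<Sum>i<n. v i * (P i j - h i j * \<beta> z (y j))) = g z (y j)" for z
    by (rule square_system_solvable) (rule inj)
  then obtain a' where a': "\<And>z j. j < n \<Longrightarrow> (\<Sum>i<n. a' z i * (P i j - h i j * \<beta> z (y j))) = g z (y j)"
    by metis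
  define a where "a i z = a' z i" for i z
  have a: "(\<Sum>i<n. a i z * P i j) = g z (y j) + \<beta> z (y j) * (\<Sum>i<n. a i z * h i j)" if "j < n" for z j
    using a'[OF that, of z] by (simp add: a_def right_diff_distrib sum_subtractf sum_distrib_left algebra_simps)
  \<comment> \<open>At the node \<open>y m\<close> the \<open>m\<close>-th unit vector also solves
    the system, and solutions are unique by \<open>inj\<close>.\<close>
  have node: "a i (y m) = (if i = m then 1 else 0)" if "i < n" "m < n" for i m
  proof -
    have "a i (y m) - (if i = m then 1 else 0) = 0"
    proof (rule inj[of "\<lambda>i. a i (y m) - (if i = m then 1 else 0)" "y m" i])
      fix j assume j: "j < n"
      have "(\<Sum>i<n. (a i (y m) - (if i = m then 1 else 0)) * (P i j - h i j * \<beta> (y m) (y j)))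
        = (\<Sum>i<n. a i (y m) * (P i j - h i j * \<beta> (y m) (y j)))
          - (\<Sum>i<n. if i = m then P i j - h i j * \<beta> (y m) (y j) else 0)"
        unfolding left_diff_distrib sum_subtractf by (intro arg_cong2[of _ _ _ _ "(-)"] sum.cong refl) auto
      also have "\<dots> = 0" using a'[OF j, of "y m"] that by (simp add: a_def P_eq)
      finally show "(\<Sum>i<n. (a i (y m) - (if i = m then 1 else 0)) * (P i j - h i j * \<beta> (y m) (y j))) = 0" .
    qed (fact that(1))
    then show ?thesis by simp
  qed
  define H where "H z w = (\<Sum>i<n. \<Sum>j<n. a i z * cnj (a j w) * h i j)" for z w
  define K where "K z w = g z w + \<beta> z w * H z w" for z w
  have psd_H: "psd_kernel H"
    unfolding H_def[abs_def] using psd_combine[OF psd_h, of "{..<n}" a "\<lambda>i _. i"] by simp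
  have psd_K: "psd_kernel K"
    unfolding K_def[abs_def] by (intro psd_add g psd_mult psd_\<beta> psd_H)
  have Hy: "H z (y j) = (\<Sum>i<n. a i z * h i j)" if j: "j < n" for z j
  proof -
    have "(\<Sum>k<n. a i z * cnj (a k (y j)) * h i k) = (\<Sum>k<n. if k = j then a i z * h i k else 0)" for i
      using j by (intro sum.cong refl) (auto simp: node)
    then show ?thesis using j by (simp add: H_def)
  qed
  have Ky: "K z (y j) = (\<Sum>i<n. a i z * P i j)" if j: "j < n" for z j
    using a[OF j] Hy[OF j] by (simp add: K_def)
  have Kyy: "K (y i) (y j) = P i j" if "i < n" "j < n" for i j
  proof -
    have "K (y i) (y j) = (\<Sum>k<n. if k = i then P k j else 0)"
      unfolding Ky[OF that(2)] using that by (intro sum.cong refl) (auto simp: node)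
    then show ?thesis using that by simp
  qed
  have "psd_kernel (\<lambda>z w. K z w - (\<Sum>i<n. \<Sum>j<n. a i z * cnj (a j w) * K (y i) (y j)))"
  proof (rule psd_project[OF psd_K])
    show "K z (y j) = (\<Sum>i<n. a i z * K (y i) (y j))" if "j < n" for z j
      by (subst Ky[OF that]) (simp add: Kyy that)
  qed
  moreover have "(\<Sum>i<n. \<Sum>j<n. a i z * cnj (a j w) * K (y i) (y j))
      = (\<Sum>i<n. \<Sum>j<n. a i z * cnj (a j w) * \<rho> i j) + H z w" for z w
    by (simp add: Kyy P_def H_def distrib_left sum.distrib)
  ultimately have "psd_kernel (\<lambda>z w. K z w - ((\<Sum>i<n. \<Sum>j<n. a i z * cnj (a j w) * \<rho> i j) + H z w))"
    by simp
  from psd_add[OF psd_mult[OF psd_s this] psd_H]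
  have 1: "psd_kernel (\<lambda>z w. s z w * (K z w - ((\<Sum>i<n. \<Sum>j<n. a i z * cnj (a j w) * \<rho> i j) + H z w)) + H z w)" .
  \<comment> \<open>Since \<open>s (1 - \<beta>) = 1\<close>, the added \<open>H\<close> absorbs the
    difference between \<open>K - H\<close> and \<open>g\<close>.\<close>
  have "s z w * (K z w - (R + H z w)) + H z w = s z w * (g z w - R)" for z w R
    using one_minus_\<beta>[of z w] by (simp add: K_def s_eq field_simps)
  with 1 have "psd_kernel (\<lambda>z w. s z w * (g z w - (\<Sum>i<n. \<Sum>j<n. a i z * cnj (a j w) * \<rho> i j)))"
    by simp
  with node show ?thesis by (rule that)
qed

subsection \<open>Interpolation\<close>

text \<open>For the diagonal matrix \<open>\<rho>\<close> with entries
  \<open>\<kappa> l_ii / s_ii\<close>, the product \<open>s \<rho>\<close> on the nodes is diagonal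
  with entries \<open>\<kappa> l_ii\<close>. The hypothesis of the Leech extension is then the Riesz
  bound.\<close>

lemma (in pick_kernel) row_extension:
  assumes g: "psd_kernel g" and l: "\<And>z w. l z w = s z w * g z w" and l_pos: "\<And>z. 0 < Re (l z z)"
    and \<kappa>: "0 < \<kappa>"
    and riesz: "\<And>n c. \<kappa> * (\<Sum>i<n. (cmod (c i))\<^sup>2 * Re (l (lam i) (lam i))) \<le> Re (gram l n lam c)"
  obtains a where "\<And>i j. i < n \<Longrightarrow> j < n \<Longrightarrow> a i (lam j) = (if i = j then 1 else 0)"
    "psd_kernel (\<lambda>z w. l z w - s z w * (\<Sum>i<n. of_real (\<kappa> * (Re (l (lam i) (lam i)) / Re (s (lam i) (lam i)))) *
       (a i z * cnj (a i w))))"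
proof -
  have psd_l: "psd_kernel l" using psd_mult[OF psd_s g] by (simp add: l[abs_def])
  let ?R = "\<lambda>i. Re (l (lam i) (lam i)) / Re (s (lam i) (lam i))"
  define \<rho> where "\<rho> i j = (if i = j then complex_of_real (\<kappa> * ?R i) else 0)" for i j
  have s_pos: "0 < Re (s z z)" for z using s_diag[of z] by simp
  have R_pos: "0 < \<kappa> * ?R i" for i using \<kappa> l_pos s_pos by simp
  have gram_\<rho>: "gram \<rho> n (\<lambda>i. i) c = of_real (\<Sum>i<n. (cmod (c i))\<^sup>2 * (\<kappa> * ?R i))" for n c
    unfolding \<rho>_def[abs_def] by (rule gram_diagonal)
  have \<rho>: "psd_kernel \<rho>"
    by (rule psdI_gram_nat, unfold gram_\<rho>, rule complex_of_real_nonneg)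
       (intro sum_nonneg mult_nonneg_nonneg[OF zero_le_power2 less_imp_le[OF R_pos]])
  have pos: "c i = 0" if "gram \<rho> n (\<lambda>i. i) c = 0" "i < n" for c i
  proof -
    have "(\<Sum>i<n. (cmod (c i))\<^sup>2 * (\<kappa> * ?R i)) = 0"
      using that(1) unfolding gram_\<rho> of_real_eq_0_iff .
    moreover have "0 \<le> (cmod (c i))\<^sup>2 * (\<kappa> * ?R i)" for i
      by (rule mult_nonneg_nonneg[OF zero_le_power2 less_imp_le[OF R_pos]])
    ultimately have "(cmod (c i))\<^sup>2 * (\<kappa> * ?R i) = 0"
      using that(2) by (simp only: sum_nonneg_eq_0_iff finite_lessThan lessThan_iff ball_simps)
    then show ?thesis using R_pos[of i] by (simp only: mult_eq_0_iff power_eq_0_iff norm_eq_zero) auto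
  qed
  have h: "psd_kernel (\<lambda>i j. s (lam i) (lam j) * (g (lam i) (lam j) - \<rho> i j))"
  proof -
    let ?D = "\<lambda>i j. if i = j then complex_of_real (\<kappa> * Re (l (lam i) (lam i))) else 0"
    have "s (lam i) (lam j) * \<rho> i j = ?D i j" for i j
    proof (cases "i = j")
      case True
      let ?S = "Re (s (lam j) (lam j))"
      have "s (lam j) (lam j) * of_real (\<kappa> * ?R j) = of_real ?S * of_real (\<kappa> * ?R j)"
        by (simp only: psd_diag_of_real[OF psd_s])
      also have "\<dots> = of_real (?S * (\<kappa> * ?R j))" by (simp only: of_real_mult)
      also have "?S * (\<kappa> * ?R j) = \<kappa> * Re (l (lam j) (lam j))" using s_pos[of "lam j"] by simp
      finally show ?thesis by (simp only: \<rho>_def True if_True refl)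
    qed (simp add: \<rho>_def)
    then have "(\<lambda>i j. s (lam i) (lam j) * (g (lam i) (lam j) - \<rho> i j))
        = (\<lambda>i j. 1 * l (lam i) (lam j) - ?D i j)"
      by (simp add: l right_diff_distrib fun_eq_iff)
    moreover have "psd_kernel (\<lambda>i j. 1 * l (lam i) (lam j) - ?D i j)"
    proof (rule psdI_gram_nat)
      fix n c
      have "gram (\<lambda>i j. l (lam i) (lam j)) n (\<lambda>i. i) c = of_real (Re (gram l n lam c))"
        by (simp add: gram_of_real[OF psd_l]) (simp add: gram_def)
      moreover have "0 \<le> Re (gram l n lam c) - (\<Sum>i<n. (cmod (c i))\<^sup>2 * (\<kappa> * Re (l (lam i) (lam i))))"
        using riesz[where n = n and c = c] by (simp add: sum_distrib_left mult_ac)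
      ultimately show "0 \<le> gram (\<lambda>i j. 1 * l (lam i) (lam j) - ?D i j) n (\<lambda>i. i) c"
        unfolding gram_diff gram_diagonal by (simp add: less_eq_complex_def)
    qed
    ultimately show ?thesis by simp
  qed
  obtain a where a: "\<And>i j. i < n \<Longrightarrow> j < n \<Longrightarrow> a i (lam j) = (if i = j then 1 else 0)"
      "psd_kernel (\<lambda>z w. s z w * (g z w - (\<Sum>i<n. \<Sum>j<n. a i z * cnj (a j w) * \<rho> i j)))"
    using leech_extension[where y = lam and g = g and \<rho> = \<rho> and n = n, OF g \<rho> _ h] pos by blast
  have "(\<Sum>j<n. a i z * cnj (a j w) * \<rho> i j) = of_real (\<kappa> * ?R i) * (a i z * cnj (a i w))" if "i < n" for i z w
  proof -
    have "(\<Sum>j<n. a i z * cnj (a j w) * \<rho> i j) = (\<Sum>j<n. if i = j then of_real (\<kappa> * ?R i) * (a i z * cnj (a i w)) else 0)"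
      by (intro sum.cong refl) (simp add: \<rho>_def)
    then show ?thesis using that by simp
  qed
  then have "(\<Sum>i<n. \<Sum>j<n. a i z * cnj (a j w) * \<rho> i j) = (\<Sum>i<n. of_real (\<kappa> * ?R i) * (a i z * cnj (a i w)))" for z w
    by (intro sum.cong refl) simp
  with a(2) have "psd_kernel (\<lambda>z w. l z w - s z w * (\<Sum>i<n. of_real (\<kappa> * ?R i) * (a i z * cnj (a i w))))"
    by (simp only: right_diff_distrib l[symmetric])
  with a(1) show ?thesis by (rule that)
qed

text \<open>A bounded column multiplier is an ordinary multiplier for the enlarged space \<open>X \<times> nat\<close>, with
  \<open>\<lambda>\<^sub>i\<close> placed on the \<open>i\<close>-th copy of \<open>X\<close>; the Carleson condition is the Pick condition there.\<close>

lemma (in pick_kernel) column_extension: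
  assumes C: "0 < C"
    and carl: "psd_kernel (\<lambda>i j. (if i = j then of_real (C * Re (s (lam i) (lam i))) else 0) - s (lam i) (lam j))"
  obtains \<psi> where "\<And>j. j < n \<Longrightarrow> \<psi> (lam j, j) = 1"
    "psd_kernel (\<lambda>p q. s (fst p) (fst q) * ((if snd p = (snd q :: nat) then of_real (C + 1) else 0) - \<psi> p * cnj (\<psi> q)))"
proof -
  interpret X: pick_kernel "\<lambda>p q. \<beta> (fst p) (fst q)" "\<lambda>p q :: 'x \<times> nat. s (fst p) (fst q)"
  proof
    show "psd_kernel (\<lambda>p q :: 'x \<times> nat. \<beta> (fst p) (fst q))"
      using psd_weight[OF psd_\<beta>, where f = "\<lambda>_. 1" and p = fst] by simp
  qed (rule \<beta>_less s_eq)+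
  have eq_psd: "psd_kernel (\<lambda>i j::nat. if i = j then complex_of_real t else 0)" if "0 \<le> t" for t
    by (rule psdI_gram_nat, unfold gram_diagonal, rule complex_of_real_nonneg)
       (use that in \<open>auto intro!: sum_nonneg\<close>)
  define G where "G p q = (if snd p = snd q then complex_of_real (C + 1) else 0)" for p q :: "'x \<times> nat"
  \<comment> \<open>The all-ones matrix encodes the target values 1. The identity is added to make
    \<open>\<rho>\<close> strictly positive, at the price of \<open>C + 1\<close> in place of
    \<open>C\<close> in \<open>G\<close>.\<close>
  define \<rho> where "\<rho> i j = 1 + (if i = j then complex_of_real 1 else 0)" for i j :: nat
  have G: "psd_kernel G"
    using psd_weight[OF eq_psd[of "C + 1"], where f = "\<lambda>_. 1" and p = snd] C by (simp add: G_def[abs_def])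
  have \<rho>: "psd_kernel \<rho>"
    unfolding \<rho>_def[abs_def] by (intro psd_add psd_const eq_psd) (simp_all add: less_eq_complex_def)
  have gram_\<rho>: "gram \<rho> n (\<lambda>i. i) c = gram (\<lambda>i j. 1) n (\<lambda>i. i) c + of_real (\<Sum>i<n. (cmod (c i))\<^sup>2 * 1)" for n c
    unfolding gram_diagonal[symmetric] by (simp add: gram_def \<rho>_def distrib_left sum.distrib)
  have pos: "c i = 0" if 0: "gram \<rho> n (\<lambda>i. i) c = 0" and i: "i < n" for c i
  proof -
    have "0 \<le> Re (gram (\<lambda>i j. 1) n (\<lambda>i::nat. i) c)"
      by (intro gram_Re_nonneg psd_const) (simp add: less_eq_complex_def)
    then have "(\<Sum>i<n. (cmod (c i))\<^sup>2) \<le> 0"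
      using arg_cong[OF 0[unfolded gram_\<rho>], of Re] by simp
    then have "(\<Sum>i<n. (cmod (c i))\<^sup>2) = 0"
      by (intro antisym sum_nonneg) auto
    then show ?thesis using i by (simp add: sum_nonneg_eq_0_iff)
  qed
  have "s (lam i) (lam j) * (G (lam i, i) (lam j, j) - \<rho> i j)
      = (if i = j then of_real (C * Re (s (lam i) (lam i))) else 0) - s (lam i) (lam j)" for i j
    by (simp add: G_def \<rho>_def psd_diag_of_real[OF psd_s] algebra_simps)
  with carl have h: "psd_kernel (\<lambda>i j. s (fst (lam i, i)) (fst (lam j, j)) * (G (lam i, i) (lam j, j) - \<rho> i j))"
    by simp
  obtain a where a: "\<And>i j. i < n \<Longrightarrow> j < n \<Longrightarrow> a i (lam j, j) = (if i = j then 1 else 0)"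
    "psd_kernel (\<lambda>p q. s (fst p) (fst q) * (G p q - (\<Sum>i<n. \<Sum>j<n. a i p * cnj (a j q) * \<rho> i j)))"
    using X.leech_extension[where y = "\<lambda>j. (lam j, j)" and g = G and \<rho> = \<rho> and n = n, OF G \<rho> _ h] pos by blast
  \<comment> \<open>The all-ones part of \<open>\<rho>\<close> produces
    \<open>\<psi> \<psi>^*\<close>; the identity part gives a positive kernel, which is added back
    and disappears from the inequality.\<close>
  define \<psi> where "\<psi> p = (\<Sum>i<n. a i p)" for p
  have "\<psi> (lam j, j) = 1" if "j < n" for j
  proof -
    have "\<psi> (lam j, j) = (\<Sum>i<n. if i = j then 1 else 0)"
      unfolding \<psi>_def using a(1) that by (intro sum.cong refl) auto
    then show ?thesis using that by simp
  qed
  moreover have "psd_kernel (\<lambda>p q. s (fst p) (fst q) * (G p q - \<psi> p * cnj (\<psi> q)))"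
  proof -
    have inner: "(\<Sum>j<n. a i p * cnj (a j q) * \<rho> i j) = a i p * cnj (\<psi> q) + a i p * cnj (a i q)" if "i < n" for i p q
    proof -
      have "(\<Sum>j<n. a i p * cnj (a j q) * \<rho> i j) = (\<Sum>j<n. a i p * cnj (a j q) + (if i = j then a i p * cnj (a i q) else 0))"
        by (intro sum.cong refl) (simp add: \<rho>_def algebra_simps)
      then show ?thesis using that by (simp add: sum.distrib \<psi>_def sum_distrib_left)
    qed
    have "(\<Sum>i<n. \<Sum>j<n. a i p * cnj (a j q) * \<rho> i j) = \<psi> p * cnj (\<psi> q) + (\<Sum>i<n. a i p * cnj (a i q))" for p q
      by (simp add: inner sum.distrib) (simp add: \<psi>_def sum_distrib_right)
    with a(2) have 1: "psd_kernel (\<lambda>p q. s (fst p) (fst q) * (G p q - (\<psi> p * cnj (\<psi> q) + (\<Sum>i<n. a i p * cnj (a i q)))))"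
      by simp
    have 2: "psd_kernel (\<lambda>p q. s (fst p) (fst q) * (\<Sum>i<n. a i p * cnj (a i q)))"
      by (intro psd_mult[OF X.psd_s] psd_finite_sum psd_rank_one)
    show ?thesis
      using psd_add[OF 1 2]
      by (simp only: distrib_left[symmetric] diff_diff_add[symmetric] diff_add_cancel)
  qed
  ultimately show ?thesis unfolding G_def by (rule that)
qed

text \<open>Each function \<open>A i\<close> is the product of a rescaled row entry and the
  restriction of the column to the \<open>i\<close>-th copy. The column bound controls
  \<open>\<Sum> w i A i\<close> by the row, and the row bound controls the row by
  \<open>l\<close>.\<close>

lemma (in pick_kernel) finite_interpolation:
  assumes g: "psd_kernel g" and l: "\<And>z w. l z w = s z w * g z w" and l_pos: "\<And>z. 0 < Re (l z z)"
    and \<kappa>: "0 < \<kappa>"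
    and riesz: "\<And>n c. \<kappa> * (\<Sum>i<n. (cmod (c i))\<^sup>2 * Re (l (lam i) (lam i))) \<le> Re (gram l n lam c)"
    and C: "0 < C"
    and carl: "psd_kernel (\<lambda>i j. (if i = j then of_real (C * Re (s (lam i) (lam i))) else 0) - s (lam i) (lam j))"
  obtains A where
    "\<And>i j. i < n \<Longrightarrow> j < n \<Longrightarrow> A i (lam j) = (if i = j then of_real (sqrt (Re (l (lam i) (lam i)) / Re (s (lam i) (lam i)))) else 0)"
    "\<And>w. \<forall>i. cmod (w i) \<le> 1 \<Longrightarrow> psd_kernel (\<lambda>x y. of_real ((C + 1) / \<kappa>) * l x y -
        (\<Sum>i<n. w i * A i x) * cnj (\<Sum>i<n. w i * A i y) * s x y)"
proof -
  let ?R = "\<lambda>i. Re (l (lam i) (lam i)) / Re (s (lam i) (lam i))"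
  have R: "0 \<le> ?R i" for i using l_pos[of "lam i"] s_diag[of "lam i"] by simp
  obtain a where a: "\<And>i j. i < n \<Longrightarrow> j < n \<Longrightarrow> a i (lam j) = (if i = j then 1 else 0)"
    "psd_kernel (\<lambda>z w. l z w - s z w * (\<Sum>i<n. of_real (\<kappa> * ?R i) * (a i z * cnj (a i w))))"
    using row_extension[OF g l l_pos \<kappa> riesz] by blast
  obtain \<psi> where \<psi>: "\<And>j. j < n \<Longrightarrow> \<psi> (lam j, j) = 1"
    "psd_kernel (\<lambda>p q. s (fst p) (fst q) * ((if snd p = (snd q :: nat) then of_real (C + 1) else 0) - \<psi> p * cnj (\<psi> q)))"
    using column_extension[OF C carl] by blast
  define A where "A i z = of_real (sqrt (?R i)) * a i z * \<psi> (z, i)" for i z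
  have "A i (lam j) = (if i = j then of_real (sqrt (?R i)) else 0)" if "i < n" "j < n" for i j
    using a(1)[OF that] \<psi>(1)[OF that(2)] by (simp add: A_def)
  moreover have "psd_kernel (\<lambda>x y. of_real ((C + 1) / \<kappa>) * l x y -
        (\<Sum>i<n. w i * A i x) * cnj (\<Sum>i<n. w i * A i y) * s x y)" if w: "\<forall>i. cmod (w i) \<le> 1" for w
  proof -
    define e where "e i z = w i * of_real (sqrt (?R i)) * a i z" for i z
    have ee: "e i x * cnj (e i y) = of_real ((cmod (w i))\<^sup>2 * ?R i) * (a i x * cnj (a i y))" for i x y
    proof -
      have "complex_of_real (sqrt (?R i)) * of_real (sqrt (?R i)) = of_real (?R i)"
        using R[of i] by (simp only: of_real_mult[symmetric] real_sqrt_mult_self abs_of_nonneg)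
      moreover have "e i x * cnj (e i y) = (w i * cnj (w i)) * (of_real (sqrt (?R i)) * of_real (sqrt (?R i))) * (a i x * cnj (a i y))"
        by (simp only: e_def complex_cnj_mult complex_cnj_complex_of_real mult_ac)
      ultimately show ?thesis by (simp only: complex_norm_square[symmetric] of_real_mult)
    qed
    let ?k = "\<lambda>p q. s (fst p) (fst q) * ((if snd p = (snd q :: nat) then of_real (C + 1) else 0) - \<psi> p * cnj (\<psi> q))"
    \<comment> \<open>Compresses the column inequality along the row \<open>e\<close>. The Kronecker
      delta keeps the diagonal terms of the row, while \<open>\<psi> \<psi>^*\<close> collapses to
      the rank-one kernel of \<open>\<Sum> w i A i\<close>.\<close>
    have "psd_kernel (\<lambda>x y. \<Sum>i<n. \<Sum>j<n. e i x * cnj (e j y) * ?k (x, i) (y, j))"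
      by (rule psd_combine[OF \<psi>(2)]) simp
    moreover have "(\<Sum>i<n. \<Sum>j<n. e i x * cnj (e j y) * ?k (x, i) (y, j)) =
       of_real (C + 1) * (s x y * (\<Sum>i<n. of_real ((cmod (w i))\<^sup>2 * ?R i) * (a i x * cnj (a i y))))
        - (\<Sum>i<n. w i * A i x) * cnj (\<Sum>i<n. w i * A i y) * s x y" for x y
    proof -
      have "(\<Sum>j<n. e i x * cnj (e j y) * ?k (x, i) (y, j)) =
          of_real (C + 1) * s x y * (e i x * cnj (e i y)) - (e i x * \<psi> (x, i)) * (\<Sum>j<n. cnj (e j y * \<psi> (y, j))) * s x y"
        if "i < n" for i
      proof -
        have "(\<Sum>j<n. e i x * cnj (e j y) * ?k (x, i) (y, j)) =
          (\<Sum>j<n. (if i = j then of_real (C + 1) * s x y * (e i x * cnj (e i y)) else 0)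
            - (e i x * \<psi> (x, i)) * cnj (e j y * \<psi> (y, j)) * s x y)"
          by (intro sum.cong refl) (simp add: algebra_simps)
        then show ?thesis using that by (simp add: sum_subtractf sum_distrib_left sum_distrib_right mult_ac)
      qed
      then have "(\<Sum>i<n. \<Sum>j<n. e i x * cnj (e j y) * ?k (x, i) (y, j)) =
          (\<Sum>i<n. of_real (C + 1) * s x y * (e i x * cnj (e i y))
             - (e i x * \<psi> (x, i)) * (\<Sum>j<n. cnj (e j y * \<psi> (y, j))) * s x y)"
        by (intro sum.cong refl) blast
      also have "\<dots> = of_real (C + 1) * (s x y * (\<Sum>i<n. e i x * cnj (e i y))) -
          (\<Sum>i<n. e i x * \<psi> (x, i)) * (\<Sum>j<n. cnj (e j y * \<psi> (y, j))) * s x y"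
        unfolding sum_subtractf sum_distrib_left[symmetric] sum_distrib_right[symmetric]
        by (simp only: mult.assoc)
      also have "(\<Sum>j<n. cnj (e j y * \<psi> (y, j))) = cnj (\<Sum>i<n. w i * A i y)"
        unfolding cnj_sum by (simp add: e_def A_def mult_ac)
      also have "(\<Sum>i<n. e i x * \<psi> (x, i)) = (\<Sum>i<n. w i * A i x)"
        by (simp add: e_def A_def mult_ac)
      finally show ?thesis unfolding ee .
    qed
    ultimately have 1: "psd_kernel (\<lambda>x y. of_real (C + 1) * (s x y * (\<Sum>i<n. of_real ((cmod (w i))\<^sup>2 * ?R i) * (a i x * cnj (a i y))))
        - (\<Sum>i<n. w i * A i x) * cnj (\<Sum>i<n. w i * A i y) * s x y)"
      by simp
    \<comment> \<open>Adding the positive terms with weights \<open>1 - |w i|^2\<close> removes the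
      dependence on \<open>w\<close> from the upper bound.\<close>
    have "psd_kernel (\<lambda>x y. of_real (C + 1) * (s x y * (\<Sum>i<n. of_real ((1 - (cmod (w i))\<^sup>2) * ?R i) * (a i x * cnj (a i y)))))"
    proof (rule psd_scale[OF psd_mult[OF psd_s psd_finite_sum[OF psd_scale[OF psd_rank_one]]]])
      show "0 \<le> complex_of_real (C + 1)" using C by (intro complex_of_real_nonneg) simp
      show "0 \<le> complex_of_real ((1 - (cmod (w i))\<^sup>2) * ?R i)" for i
        using w[rule_format, of i] R[of i] by (intro complex_of_real_nonneg mult_nonneg_nonneg) (auto simp: power_le_one)
    qed
    from psd_add[OF 1 this]
    have "psd_kernel (\<lambda>x y. of_real (C + 1) * (s x y * (S1 x y + S2 x y)) - W x y)"
      if "S1 = (\<lambda>x y. \<Sum>i<n. of_real ((cmod (w i))\<^sup>2 * ?R i) * (a i x * cnj (a i y)))"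
        "S2 = (\<lambda>x y. \<Sum>i<n. of_real ((1 - (cmod (w i))\<^sup>2) * ?R i) * (a i x * cnj (a i y)))"
        "W = (\<lambda>x y. (\<Sum>i<n. w i * A i x) * cnj (\<Sum>i<n. w i * A i y) * s x y)" for S1 S2 W
      unfolding that by (simp only: distrib_left add_diff_eq diff_add_eq add.commute)
    moreover have "(\<Sum>i<n. of_real ((cmod (w i))\<^sup>2 * ?R i) * (a i x * cnj (a i y))) +
          (\<Sum>i<n. of_real ((1 - (cmod (w i))\<^sup>2) * ?R i) * (a i x * cnj (a i y))) =
          (\<Sum>i<n. of_real (?R i) * (a i x * cnj (a i y)))" for x y
      unfolding sum.distrib[symmetric] distrib_right[symmetric] of_real_add[symmetric] by simp
    ultimately have 2: "psd_kernel (\<lambda>x y. of_real (C + 1) * (s x y * (\<Sum>i<n. of_real (?R i) * (a i x * cnj (a i y))))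
        - (\<Sum>i<n. w i * A i x) * cnj (\<Sum>i<n. w i * A i y) * s x y)"
      by simp
    have 3: "psd_kernel (\<lambda>x y. of_real ((C + 1) / \<kappa>) * (l x y - s x y * (\<Sum>i<n. of_real (\<kappa> * ?R i) * (a i x * cnj (a i y)))))"
      using C \<kappa> by (intro psd_scale a(2) complex_of_real_nonneg) simp
    have "(\<Sum>i<n. of_real (\<kappa> * ?R i) * (a i x * cnj (a i y))) = of_real \<kappa> * (\<Sum>i<n. of_real (?R i) * (a i x * cnj (a i y)))" for x y
      by (simp add: sum_distrib_left mult_ac)
    moreover have "of_real (C + 1) * (\<sigma> * t) - v + of_real ((C + 1) / \<kappa>) * (u - \<sigma> * (of_real \<kappa> * t))
        = of_real ((C + 1) / \<kappa>) * u - v" for \<sigma> t u v :: complex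
      using \<kappa> by (simp add: field_simps)
    ultimately show ?thesis using psd_add[OF 2 3] by (simp only:)
  qed
  ultimately show ?thesis by (rule that)
qed

section \<open>Compactness and the passage to the full sequence\<close>

lemma closed_Collect_psd:
  assumes "\<And>z w. continuous_on UNIV (\<lambda>A. K A z w)"
  shows "closed {A. psd_kernel (K A)}"
proof -
  have cont: "continuous_on UNIV (\<lambda>A. gram (K A) n x c)" for n x c
    unfolding gram_def by (intro continuous_intros assms)
  have "{A. psd_kernel (K A)} = (\<Inter>n. \<Inter>x. \<Inter>c. {A. 0 \<le> Re (gram (K A) n x c)} \<inter> {A. Im (gram (K A) n x c) = 0})"
    unfolding psd_iff_gram by (auto simp: less_eq_complex_def)
  also have "closed \<dots>"
    by (intro closed_INT ballI closed_Int closed_Collect_le closed_Collect_eq continuous_intros cont)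
  finally show ?thesis .
qed

lemma compact_PiE_UNIV:
  fixes S :: "'i \<Rightarrow> 'a :: topological_space set"
  assumes "\<And>i. compact (S i)"
  shows "compact (PiE UNIV S)"
proof -
  have "compactin (product_topology (\<lambda>i::'i. euclidean :: 'a topology) UNIV) (PiE UNIV S)"
    unfolding compactin_PiE using assms by simp
  then show ?thesis by (simp add: euclidean_product_topology)
qed

text \<open>The constraints on the first \<open>n\<close> functions form a closed set
  \<open>F n\<close>. The diagonal of the kernel inequality and \<open>s z z \<ge> 1\<close> confine
  the values at \<open>z\<close> to a disc of radius \<open>B z\<close>, so Tychonoff's theorem and
  the finite solutions give a common point.\<close>

lemma (in pick_kernel) interpolation_sequence:
  assumes g: "psd_kernel g" and l: "\<And>z w. l z w = s z w * g z w" and l_pos: "\<And>z. 0 < Re (l z z)"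
    and \<kappa>: "0 < \<kappa>"
    and riesz: "\<And>n c. \<kappa> * (\<Sum>i<n. (cmod (c i))\<^sup>2 * Re (l (lam i) (lam i))) \<le> Re (gram l n lam c)"
    and C: "0 < C"
    and carl: "psd_kernel (\<lambda>i j. (if i = j then of_real (C * Re (s (lam i) (lam i))) else 0) - s (lam i) (lam j))"
  obtains A where
    "\<And>i j. A i (lam j) = (if i = j then of_real (sqrt (Re (l (lam i) (lam i)) / Re (s (lam i) (lam i)))) else 0)"
    "\<And>n w. \<forall>i. cmod (w i) \<le> 1 \<Longrightarrow> psd_kernel (\<lambda>x y. of_real ((C + 1) / \<kappa>) * l x y -
        (\<Sum>i<n. w i * A i x) * cnj (\<Sum>i<n. w i * A i y) * s x y)"
proof -
  define M where "M = (C + 1) / \<kappa>"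
  define R where "R i j = (if i = j then complex_of_real (sqrt (Re (l (lam i) (lam i)) / Re (s (lam i) (lam i)))) else 0)" for i j
  define K where "K n w A x y = of_real M * l x y - (\<Sum>i<n. w i * A (i, x)) * cnj (\<Sum>i<n. w i * A (i, y)) * s x y"
    for n :: nat and w A x y
  define F where "F n = {A. (\<forall>i<n. \<forall>j<n. A (i, lam j) = R i j) \<and> (\<forall>w. (\<forall>i. cmod (w i) \<le> 1) \<longrightarrow> psd_kernel (K n w A))}" for n
  define B where "B z = sqrt (M * Re (l z z))" for z
  let ?S = "PiE UNIV (\<lambda>p :: nat \<times> 'x. cball (0 :: complex) (B (snd p)))"
  have closed: "closed (F n)" for n
  proof -
    have coord: "continuous_on UNIV (\<lambda>A :: nat \<times> 'x \<Rightarrow> complex. A p)" for p by simp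
    have "F n = (\<Inter>i\<in>{..<n}. \<Inter>j\<in>{..<n}. {A. A (i, lam j) = R i j}) \<inter>
        (\<Inter>w\<in>{w. \<forall>i. cmod (w i) \<le> 1}. {A. psd_kernel (K n w A)})"
      unfolding F_def by auto
    also have "closed \<dots>"
      unfolding K_def
      by (intro closed_Int closed_INT ballI closed_Collect_eq closed_Collect_psd continuous_intros coord)
    finally show ?thesis .
  qed
  have nonempty: "?S \<inter> (\<Inter>n\<in>I. F n) \<noteq> {}" if I: "finite I" for I
  proof -
    obtain N where N: "I \<subseteq> {..<N}" using I by (meson finite_nat_iff_bounded)
    obtain A where A: "\<And>i j. i < N \<Longrightarrow> j < N \<Longrightarrow> A i (lam j) = R i j"
      "\<And>w. \<forall>i. cmod (w i) \<le> 1 \<Longrightarrow> psd_kernel (\<lambda>x y. of_real M * l x y -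
        (\<Sum>i<N. w i * A i x) * cnj (\<Sum>i<N. w i * A i y) * s x y)"
      using finite_interpolation[OF g l l_pos \<kappa> riesz C carl, where n = N] unfolding R_def M_def by blast
    \<comment> \<open>Zero is a legitimate default: it lies in every disc, and indices from
      \<open>N\<close> on are constrained by no \<open>F n\<close> with
      \<open>n \<in> I\<close>.\<close>
    define A' where "A' p = (if fst p < N then A (fst p) (snd p) else 0)" for p
    have psd: "psd_kernel (K n w A')" if "n \<le> N" and w: "\<forall>i. cmod (w i) \<le> 1" for n w
    proof -
      \<comment> \<open>Truncating the weights deduces the inequality for \<open>n\<close> functions
        from that for \<open>N\<close>.\<close>
      define v where "v i = (if i < n then w i else 0)" for i
      have "(\<Sum>i<n. w i * A' (i, x)) = (\<Sum>i<N. v i * A i x)" for x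
        using \<open>n \<le> N\<close> by (intro sum.mono_neutral_cong_left) (auto simp: v_def A'_def)
      moreover have "\<forall>i. cmod (v i) \<le> 1" using w by (simp add: v_def)
      ultimately show ?thesis using A(2)[of v] by (simp add: K_def[abs_def] del: cnj_sum)
    qed
    have "A' p \<in> cball 0 (B (snd p))" for p
    proof (cases "fst p < N")
      case True
      obtain i z where p: "p = (i, z)" by (cases p)
      have i: "i < N" using True p by simp
      let ?e = "\<lambda>j. if j = i then 1 else 0 :: complex"
      have "(\<Sum>j<N. ?e j * A j x) = A i x" for x
      proof -
        have "(\<Sum>j<N. ?e j * A j x) = (\<Sum>j<N. if j = i then A i x else 0)"
          by (intro sum.cong refl) simp
        then show ?thesis using i by simp
      qed
      with A(2)[of ?e] have "psd_kernel (\<lambda>x y. of_real M * l x y - A i x * cnj (A i y) * s x y)" by simp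
      from psd_diag_Re[OF this, of z]
      have "(cmod (A i z))\<^sup>2 * Re (s z z) \<le> M * Re (l z z)"
        by (simp add: complex_norm_square[symmetric] del: of_real_power)
      moreover have "(cmod (A i z))\<^sup>2 * 1 \<le> (cmod (A i z))\<^sup>2 * Re (s z z)"
        using s_diag by (intro mult_left_mono) auto
      ultimately have "(cmod (A i z))\<^sup>2 \<le> M * Re (l z z)" by simp
      then have "cmod (A i z) \<le> B z" unfolding B_def by (rule real_le_rsqrt)
      then show ?thesis using p i by (simp add: A'_def)
    next
      case False
      have "0 \<le> B (snd p)" using C \<kappa> l_pos[of "snd p"] by (simp add: B_def M_def)
      then show ?thesis using False by (simp add: A'_def)
    qed
    then have "A' \<in> ?S" by (simp add: PiE_iff)
    moreover have "A' \<in> F n" if "n \<in> I" for n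
    proof -
      have n: "n < N" using N that by auto
      then have "A' (i, lam j) = R i j" if "i < n" "j < n" for i j
        using A(1)[of i j] that by (simp add: A'_def)
      then show ?thesis unfolding F_def using psd[of n] n by simp
    qed
    ultimately show ?thesis by blast
  qed
  have "?S \<inter> (\<Inter>n\<in>UNIV. F n) \<noteq> {}"
    by (rule compact_imp_fip_image) (auto intro!: compact_PiE_UNIV closed nonempty)
  then obtain A where A: "\<And>n. A \<in> F n" by auto
  show ?thesis
  proof
    \<comment> \<open>\<open>Suc (max i j)\<close> is large enough for both indices to lie strictly
      below it.\<close>
    show "A (i, lam j) = (if i = j then of_real (sqrt (Re (l (lam i) (lam i)) / Re (s (lam i) (lam i)))) else 0)" for i j
      using A[of "Suc (max i j)"] unfolding F_def R_def[symmetric] by (simp add: less_Suc_eq_le)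
    show "psd_kernel (\<lambda>x y. of_real ((C + 1) / \<kappa>) * l x y - (\<Sum>i<n. w i * A (i, x)) * cnj (\<Sum>i<n. w i * A (i, y)) * s x y)"
      if "\<forall>i. cmod (w i) \<le> 1" for n w
      using A[of n] that unfolding F_def M_def[symmetric] K_def[abs_def] by blast
  qed
qed

text \<open>Choosing weights that cancel the phases of the \<open>A i z\<close> at one point
  \<open>z\<close> gives absolute convergence there. The kernel inequality for unit weights is then
  rescaled by the sup norm and passed to the limit.\<close>

lemma (in pick_kernel) interpolation_operator:
  fixes A :: "nat \<Rightarrow> 'x \<Rightarrow> complex"
  assumes l_pos: "\<And>z. 0 < Re (l z z)" and M: "0 \<le> M"
    and A: "\<And>n w. \<forall>i. cmod (w i) \<le> 1 \<Longrightarrow> psd_kernel (\<lambda>x y. of_real M * l x y -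
        (\<Sum>i<n. w i * A i x) * cnj (\<Sum>i<n. w i * A i y) * s x y)"
    and w: "w \<in> linfty"
  shows "summable (\<lambda>i. w i * A i z)"
    and "0 \<le> linfty_norm w"
    and "psd_kernel (\<lambda>x y. of_real ((sqrt M * linfty_norm w)\<^sup>2) * l x y -
        (\<Sum>i. w i * A i x) * cnj (\<Sum>i. w i * A i y) * s x y)"
proof -
  let ?L = "linfty_norm w"
  obtain B where "\<And>i. cmod (w i) \<le> B" using w unfolding linfty_def by blast
  then have L: "cmod (w i) \<le> ?L" for i
    unfolding linfty_norm_def by (intro cSUP_upper bdd_aboveI2[of UNIV _ B]) simp_all
  then show L0: "0 \<le> ?L" by (rule order.trans[OF norm_ge_zero])
  have summable_A: "summable (\<lambda>i. cmod (A i z))" for z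
  proof (rule summableI_nonneg_bounded)
    fix n
    define v where "v i = cnj (sgn (A i z))" for i
    have v: "\<forall>i. cmod (v i) \<le> 1" by (simp add: v_def norm_sgn)
    have "v i * A i z = of_real (cmod (A i z))" for i
    proof (cases "A i z = 0")
      case False
      have "v i * A i z = A i z * cnj (A i z) / of_real (cmod (A i z))"
        by (simp add: v_def sgn_div_norm scaleR_conv_of_real divide_inverse mult_ac)
      also have "\<dots> = of_real ((cmod (A i z))\<^sup>2 / cmod (A i z))"
        by (simp only: complex_norm_square[symmetric] of_real_divide)
      finally show ?thesis using False by (simp add: power2_eq_square)
    qed simp
    then have "(\<Sum>i<n. v i * A i z) = of_real (\<Sum>i<n. cmod (A i z))" by simp
    moreover have "0 \<le> (\<Sum>i<n. cmod (A i z))" by (intro sum_nonneg) simp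
    ultimately have S: "cmod (\<Sum>i<n. v i * A i z) = (\<Sum>i<n. cmod (A i z))"
      by (simp only: norm_of_real abs_of_nonneg)
    have "(cmod (\<Sum>i<n. v i * A i z))\<^sup>2 * Re (s z z) \<le> M * Re (l z z)"
      using psd_diag_Re[OF A[of v n, OF v], of z]
      by (simp add: complex_norm_square[symmetric] del: of_real_power cnj_sum)
    moreover have "(cmod (\<Sum>i<n. v i * A i z))\<^sup>2 * 1 \<le> (cmod (\<Sum>i<n. v i * A i z))\<^sup>2 * Re (s z z)"
      using s_diag by (intro mult_left_mono) auto
    ultimately have "(cmod (\<Sum>i<n. v i * A i z))\<^sup>2 \<le> M * Re (l z z)" by simp
    then show "(\<Sum>i<n. cmod (A i z)) \<le> sqrt (M * Re (l z z))"
      unfolding S by (rule real_le_rsqrt)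
  qed simp
  show summ: "summable (\<lambda>i. w i * A i z)" for z
  proof (rule summable_comparison_test)
    show "summable (\<lambda>i. ?L * cmod (A i z))" by (intro summable_mult summable_A)
    show "\<exists>N. \<forall>n\<ge>N. norm (w n * A n z) \<le> ?L * cmod (A n z)"
      using L by (auto simp: norm_mult intro!: mult_right_mono)
  qed
  show "psd_kernel (\<lambda>x y. of_real ((sqrt M * ?L)\<^sup>2) * l x y -
        (\<Sum>i. w i * A i x) * cnj (\<Sum>i. w i * A i y) * s x y)"
  proof (cases "?L = 0")
    case True
    then have "w i = 0" for i using L[of i] by simp
    then show ?thesis using True by (simp add: psd_const)
  next
    case False
    define v where "v i = w i / of_real ?L" for i
    have v: "\<forall>i. cmod (v i) \<le> 1" using L False L0 by (simp add: v_def norm_divide)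
    define T where "T x = (\<Sum>i. w i * A i x)" for x
    have lim: "(\<lambda>n. \<Sum>i<n. v i * A i x) \<longlonglongrightarrow> T x / of_real ?L" for x
    proof -
      have "(\<lambda>i. w i * A i x / of_real ?L) sums (T x / of_real ?L)"
        unfolding T_def by (intro sums_divide summable_sums summ)
      then show ?thesis unfolding sums_def v_def by simp
    qed
    have "psd_kernel (\<lambda>x y. of_real M * l x y - (T x / of_real ?L) * cnj (T y / of_real ?L) * s x y)"
    proof (rule psd_lim)
      show "((\<lambda>n. of_real M * l x y - (\<Sum>i<n. v i * A i x) * cnj (\<Sum>i<n. v i * A i y) * s x y)
          \<longlongrightarrow> of_real M * l x y - (T x / of_real ?L) * cnj (T y / of_real ?L) * s x y) sequentially" for x y
        by (intro tendsto_intros lim)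
      show "\<forall>\<^sub>F n in sequentially. psd_kernel (\<lambda>x y. of_real M * l x y -
          (\<Sum>i<n. v i * A i x) * cnj (\<Sum>i<n. v i * A i y) * s x y)"
        by (intro always_eventually allI A v)
    qed simp
    from psd_scale[OF this, of "of_real (?L\<^sup>2)"]
    have "psd_kernel (\<lambda>x y. of_real (?L\<^sup>2) * (of_real M * l x y - (T x / of_real ?L) * cnj (T y / of_real ?L) * s x y))"
      by (simp add: less_eq_complex_def)
    moreover have "of_real (?L\<^sup>2) * (of_real M * a - (t / of_real ?L) * cnj (t' / of_real ?L) * b)
        = of_real ((sqrt M * ?L)\<^sup>2) * a - t * cnj t' * b" for a b t t'
      using False M by (simp add: power_mult_distrib field_simps power2_eq_square flip: of_real_mult)
    ultimately show ?thesis unfolding T_def by (simp only:)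
  qed
qed

subsection \<open>Necessity\<close>

lemma gram_cong: "(\<And>i. i < n \<Longrightarrow> c i = d i) \<Longrightarrow> gram k n x c = gram k n x d"
  unfolding gram_def by (intro sum.cong refl) simp

lemma gram_parallelogram:
  "gram k n x (\<lambda>i. c i + d i) + gram k n x (\<lambda>i. c i - d i) = 2 * gram k n x c + 2 * gram k n x d"
  unfolding gram_def sum_distrib_left sum.distrib[symmetric]
  by (intro sum.cong refl) (simp add: algebra_simps)

lemma gram_scale: "gram k n x (\<lambda>i. t * c i) = of_real ((cmod t)\<^sup>2) * gram k n x c"
  unfolding complex_norm_square by (simp add: gram_def sum_distrib_left mult_ac)

lemma gram_single:
  assumes "i < n"
  shows "gram k n x (\<lambda>p. if p = i then t else 0) = of_real ((cmod t)\<^sup>2) * k (x i) (x i)"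
proof -
  have "gram k n x (\<lambda>p. if p = i then t else 0) =
      (\<Sum>p<n. if p = i then (\<Sum>q<n. if q = i then cnj t * t * k (x i) (x i) else 0) else 0)"
    unfolding gram_def
  proof (intro sum.cong refl)
    fix p
    show "(\<Sum>q<n. cnj (if p = i then t else 0) * (if q = i then t else 0) * k (x p) (x q)) =
        (if p = i then (\<Sum>q<n. if q = i then cnj t * t * k (x i) (x i) else 0) else 0)"
    proof (cases "p = i")
      case True
      show ?thesis unfolding True if_P[OF refl] by (intro sum.cong refl) simp
    qed simp
  qed
  then show ?thesis using assms by (simp add: complex_norm_square[unfolded of_real_power] mult.commute)
qed

text \<open>Signs are chosen one at a time. By the parallelogram law the two choices for the last
  sign average to the bound, so one of them does not exceed it.\<close>

lemma balancing_signs: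
  assumes l: "psd_kernel l"
  shows "\<exists>\<sigma>. (\<forall>i. \<sigma> i = 1 \<or> \<sigma> i = (-1 :: complex)) \<and>
     Re (gram l n x (\<lambda>i. \<sigma> i * c i)) \<le> (\<Sum>i<n. (cmod (c i))\<^sup>2 * Re (l (x i) (x i)))"
proof (induction n)
  case 0
  show ?case by (rule exI[of _ "\<lambda>_. 1"]) (simp add: gram_def)
next
  case (Suc n)
  obtain \<sigma> where \<sigma>: "\<And>i. \<sigma> i = 1 \<or> \<sigma> i = (-1 :: complex)"
    "Re (gram l n x (\<lambda>i. \<sigma> i * c i)) \<le> (\<Sum>i<n. (cmod (c i))\<^sup>2 * Re (l (x i) (x i)))"
    using Suc by blast
  define e where "e i = (if i < n then \<sigma> i * c i else 0)" for i
  define f where "f i = (if i = n then c n else 0)" for i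
  let ?g = "\<lambda>c. Re (gram l (Suc n) x c)"
  have "gram l (Suc n) x e = gram l n x (\<lambda>i. \<sigma> i * c i)"
    by (simp add: gram_def e_def)
  moreover have "gram l (Suc n) x f = of_real ((cmod (c n))\<^sup>2) * l (x n) (x n)"
    unfolding f_def[abs_def] by (rule gram_single) simp
  ultimately have "?g (\<lambda>i. e i + f i) + ?g (\<lambda>i. e i - f i) =
      2 * Re (gram l n x (\<lambda>i. \<sigma> i * c i)) + 2 * ((cmod (c n))\<^sup>2 * Re (l (x n) (x n)))"
    using arg_cong[OF gram_parallelogram[where k = l and n = "Suc n" and x = x and c = e and d = f], of Re] by simp
  then have disj: "?g (\<lambda>i. e i + f i) \<le> (\<Sum>i<Suc n. (cmod (c i))\<^sup>2 * Re (l (x i) (x i))) \<or>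
      ?g (\<lambda>i. e i - f i) \<le> (\<Sum>i<Suc n. (cmod (c i))\<^sup>2 * Re (l (x i) (x i)))"
    using \<sigma>(2) by (simp only: sum.lessThan_Suc) linarith
  have eq: "?g (\<lambda>i. e i + f i) = ?g (\<lambda>i. (\<sigma>(n := 1)) i * c i)"
    "?g (\<lambda>i. e i - f i) = ?g (\<lambda>i. (\<sigma>(n := -1)) i * c i)"
    by (intro arg_cong[of _ _ Re] gram_cong; simp add: e_def f_def)+
  have "\<forall>i. (\<sigma>(n := t)) i = 1 \<or> (\<sigma>(n := t)) i = -1" if "t = 1 \<or> t = -1" for t
    using \<sigma>(1) that by simp
  with disj[unfolded eq] show ?case by blast
qed

section \<open>Uniform bounds by Baire category\<close>

lemma continuous_on_bcontfun_eval: "continuous_on UNIV (\<lambda>f. apply_bcontfun f i)"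
proof -
  have "dist (apply_bcontfun f i) (apply_bcontfun g i) \<le> dist f g" for f g :: "'a \<Rightarrow>\<^sub>C 'b"
    by (rule dist_bounded)
  then show ?thesis unfolding continuous_on_iff by (meson le_less_trans)
qed

text \<open>Type \<open>nat\<close> is not a metric space in the library, so the completeness of \<open>\<ell>\<^sup>\<infinity>\<close> needed for Baire's
  theorem is borrowed from the bounded continuous functions on the reals.\<close>

lemma bounded_sequence_extension:
  fixes h :: "nat \<Rightarrow> complex"
  assumes h: "\<And>i. cmod (h i) \<le> B"
  obtains H :: "real \<Rightarrow>\<^sub>C complex" where "\<And>i. apply_bcontfun H (real i) = h i" "norm H \<le> B"
proof -
  define f where "f x = h (nat \<lfloor>x\<rfloor>)" for x :: real
  have "continuous_on \<nat> f"
    unfolding continuous_on_iff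
  proof (intro ballI allI impI)
    fix x \<epsilon> :: real assume x: "x \<in> \<nat>" "0 < \<epsilon>"
    \<comment> \<open>Distinct naturals are at distance at least 1, so every function is continuous
      on them and Tietze's theorem applies.\<close>
    have "x' = x" if "x' \<in> \<nat>" "dist x' x < 1" for x'
      using x(1) that by (auto elim!: Nats_cases simp: dist_real_def)
    then have "\<forall>x'\<in>\<nat>. dist x' x < 1 \<longrightarrow> dist (f x') (f x) < \<epsilon>"
      using x(2) by (metis dist_self)
    then show "\<exists>d>0. \<forall>x'\<in>\<nat>. dist x' x < d \<longrightarrow> dist (f x') (f x) < \<epsilon>"
      by (intro exI[of _ 1]) simp
  qed
  moreover have "0 \<le> B" by (rule order.trans[OF norm_ge_zero h])
  ultimately obtain F where F: "continuous_on UNIV F" "\<And>x. x \<in> \<nat> \<Longrightarrow> F x = f x" "\<And>x. norm (F x) \<le> B"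
    using Tietze[of \<nat> f UNIV B] h by (auto simp: f_def)
  then have "F \<in> bcontfun" unfolding bcontfun_def bounded_iff by auto
  then obtain H where H: "F = apply_bcontfun H" by (rule bcontfunE)
  show ?thesis
  proof
    show "apply_bcontfun H (real i) = h i" for i
      using F(2)[of "real i"] by (simp add: H[symmetric] f_def)
    show "norm H \<le> B" by (rule norm_bound) (use F(3) H in simp)
  qed
qed

text \<open>For fixed \<open>w\<close> the multiplier inequality at the nodes bounds
  \<open>q n c w\<close> by a multiple of \<open>?G n c\<close>. Baire's theorem makes the multiple
  uniform on some ball, and the parallelogram law moves the ball to the origin.\<close>

lemma interpolating_uniform_bound:
  assumes s: "psd_kernel s" and l: "psd_kernel l" and s_pos: "\<And>z. 0 < Re (s z z)" and l_pos: "\<And>z. 0 < Re (l z z)"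
    and interp: "interpolating s l lam"
  obtains M where "0 < M" "\<And>w n c. (\<And>i. cmod (w i) \<le> 1) \<Longrightarrow>
     Re (gram s n lam (\<lambda>i. cnj (w i) * (of_real (sqrt (Re (l (lam i) (lam i)) / Re (s (lam i) (lam i)))) * c i)))
       \<le> M * Re (gram l n lam c)"
proof -
  define r where "r i = complex_of_real (sqrt (Re (l (lam i) (lam i)) / Re (s (lam i) (lam i))))" for i
  \<comment> \<open>The squared norm of the image of \<open>\<Sum> c i l_(lam i)\<close> under the
    adjoint of any multiplier with values \<open>w i * r i\<close> at the nodes.\<close>
  define q where "q n c w = Re (gram s n lam (\<lambda>i. cnj (w i) * (r i * c i)))" for n c and w :: "nat \<Rightarrow> complex"
  let ?G = "\<lambda>n c. Re (gram l n lam c)"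
  have G0: "0 \<le> ?G n c" for n c by (rule gram_Re_nonneg[OF l])
  have ex: "\<exists>m::nat. \<forall>n c. q n c w \<le> m * ?G n c" if w: "w \<in> linfty" for w
  proof -
    have "complex_of_real (kfun_norm l (lam i) / kfun_norm s (lam i)) = r i" for i
      by (simp add: r_def kfun_norm_eq s l real_sqrt_divide)
    then obtain \<phi> where \<phi>: "is_mult s l \<phi>" "\<And>i. \<phi> (lam i) = w i * r i"
      using interp[unfolded interpolating_def, rule_format, OF w] by auto
    obtain C where C: "psd_kernel (\<lambda>z w. of_real (C\<^sup>2) * l z w - \<phi> z * cnj (\<phi> w) * s z w)"
      using is_multD[OF s l \<phi>(1)] by blast
    obtain m :: nat where m: "C\<^sup>2 \<le> m" using real_arch_simple by blast
    have "q n c w \<le> m * ?G n c" for n c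
    proof -
      have "gram (\<lambda>z w. \<phi> z * cnj (\<phi> w) * s z w) n lam c = gram s n lam (\<lambda>i. cnj (w i) * (r i * c i))"
        by (simp add: gram_def \<phi>(2) r_def mult_ac)
      then have "0 \<le> C\<^sup>2 * ?G n c - q n c w"
        using gram_Re_nonneg[OF C, where n = n and x = lam and c = c] gram_nonneg[OF l, where n = n and x = lam and c = c]
        unfolding gram_diff q_def by simp
      also have "C\<^sup>2 * ?G n c \<le> m * ?G n c" using m G0 by (rule mult_right_mono)
      finally show ?thesis by simp
    qed
    then show ?thesis by blast
  qed
  define ev :: "(real \<Rightarrow>\<^sub>C complex) \<Rightarrow> nat \<Rightarrow> complex" where "ev f i = apply_bcontfun f (real i)" for f i
  \<comment> \<open>The bounds are natural numbers so that the cover by closed sets is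
    countable.\<close>
  define E where "E m = {f. \<forall>n c. q n c (ev f) \<le> real m * ?G n c}" for m
  have closed: "closed (E m)" for m
  proof -
    have "E m = (\<Inter>n. \<Inter>c. {f. q n c (ev f) \<le> real m * ?G n c})"
      unfolding E_def by auto
    also have "closed \<dots>"
      unfolding q_def gram_def[of s] ev_def
      by (intro closed_INT ballI closed_Collect_le continuous_intros continuous_on_bcontfun_eval)
    finally show ?thesis .
  qed
  have "f \<in> (\<Union>m. E m)" for f
  proof -
    have "ev f \<in> linfty"
      using bounded_apply_bcontfun[of f] unfolding linfty_def bounded_iff ev_def by auto
    then show ?thesis using ex unfolding E_def by blast
  qed
  then have "(\<Union>m. E m) = UNIV" by blast
  then have "interior (\<Union>m. E m) \<noteq> {}" by simp
  moreover have "interior (\<Union>m. E m) = {}" if "\<And>m. interior (E m) = {}"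
  proof -
    have "T \<in> range E \<Longrightarrow> closed T \<and> interior T = {}" for T using that closed by auto
    moreover have "complete (UNIV :: (real \<Rightarrow>\<^sub>C complex) set)" by (rule Elementary_Metric_Spaces.complete_UNIV)
    ultimately show ?thesis
      using Met_TC.metric_Baire_category_alt[where \<G> = "range E"] by simp
  qed
  ultimately obtain m f where "f \<in> interior (E m)" by blast
  then obtain e where e: "e > 0" "ball f e \<subseteq> E m" by (meson mem_interior)
  have f: "q n c (ev f) \<le> m * ?G n c" for n c
  proof -
    have "f \<in> E m" using e centre_in_ball[of f e] by blast
    then show ?thesis unfolding E_def by blast
  qed
  \<comment> \<open>From \<open>(e/2)^2 q(w) \<le> 2 q(f + H) + 2 q(f)\<close>, each term on the
    right being at most \<open>2 m ?G\<close>. The added 1 makes \<open>M\<close> positive even for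
    \<open>m = 0\<close>.\<close>
  define M where "M = 4 * real m / (e / 2)\<^sup>2 + 1"
  have bound: "q n c w \<le> M * ?G n c" if w: "\<And>i. cmod (w i) \<le> 1" for w n c
  proof -
    define h where "h i = of_real (e / 2) * w i" for i
    have hb: "cmod (h i) \<le> e / 2" for i
      using w[of i] e(1) by (simp add: h_def norm_mult mult_left_le)
    then obtain H where H: "\<And>i. apply_bcontfun H (real i) = h i" "norm H \<le> e / 2"
      using bounded_sequence_extension by blast
    then have "f + H \<in> ball f e" using H(2) e(1) by (simp add: dist_norm)
    then have fH: "q n c (ev (f + H)) \<le> m * ?G n c" using e(2) unfolding E_def by blast
    let ?d = "\<lambda>w i. cnj (w i) * (r i * c i)"
    have diff: "(\<lambda>i. ?d (ev (f + H)) i - ?d (ev f) i) = (\<lambda>i. of_real (e / 2) * ?d w i)"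
      by (simp add: ev_def H(1) h_def plus_bcontfun.rep_eq algebra_simps)
    have scale: "Re (gram s n lam (\<lambda>i. of_real (e / 2) * ?d w i)) = (e / 2)\<^sup>2 * q n c w"
      unfolding gram_scale q_def norm_of_real power2_abs by simp
    have "Re (gram s n lam (\<lambda>i. ?d (ev (f + H)) i + ?d (ev f) i))
          + Re (gram s n lam (\<lambda>i. ?d (ev (f + H)) i - ?d (ev f) i))
        = 2 * q n c (ev (f + H)) + 2 * q n c (ev f)"
      using arg_cong[OF gram_parallelogram[where k = s and n = n and x = lam and
            c = "?d (ev (f + H))" and d = "?d (ev f)"], of Re]
      unfolding q_def by simp
    then have "Re (gram s n lam (\<lambda>i. ?d (ev (f + H)) i + ?d (ev f) i)) + (e / 2)\<^sup>2 * q n c w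
        = 2 * q n c (ev (f + H)) + 2 * q n c (ev f)"
      unfolding diff scale .
    moreover have "0 \<le> Re (gram s n lam (\<lambda>i. ?d (ev (f + H)) i + ?d (ev f) i))"
      by (rule gram_Re_nonneg[OF s])
    ultimately have "(e / 2)\<^sup>2 * q n c w \<le> 4 * m * ?G n c"
      using f[of n c] fH by simp
    then have "q n c w \<le> 4 * real m / (e / 2)\<^sup>2 * ?G n c"
      using e(1) by (simp add: field_simps)
    also have "\<dots> \<le> M * ?G n c" unfolding M_def using G0 by (intro mult_right_mono) auto
    finally show ?thesis .
  qed
  show ?thesis
  proof (rule that)
    show "0 < M" unfolding M_def by (rule add_nonneg_pos) simp_all
  qed (rule bound[unfolded q_def r_def])
qed

lemma interpolating_necessary:
  assumes s: "psd_kernel s" and l: "psd_kernel l" and s_pos: "\<And>z. 0 < Re (s z z)" and l_pos: "\<And>z. 0 < Re (l z z)"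
    and interp: "interpolating s l lam"
  shows "carleson s lam" "strongly_separated l lam"
proof -
  let ?S = "\<lambda>i. Re (s (lam i) (lam i))" and ?L = "\<lambda>i. Re (l (lam i) (lam i))"
  define r where "r i = sqrt (?L i / ?S i)" for i
  have r: "r i > 0" "(r i)\<^sup>2 = ?L i / ?S i" for i
    using s_pos[of "lam i"] l_pos[of "lam i"] by (simp_all add: r_def)
  obtain M where M: "0 < M" "\<And>w n c. (\<And>i. cmod (w i) \<le> 1) \<Longrightarrow>
     Re (gram s n lam (\<lambda>i. cnj (w i) * (of_real (r i) * c i))) \<le> M * Re (gram l n lam c)"
    using interpolating_uniform_bound[OF s l s_pos l_pos interp] unfolding r_def by blast
  have "Re (gram s n lam c) \<le> M * (\<Sum>i<n. (cmod (c i))\<^sup>2 * ?S i)" for n c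
  proof -
    obtain \<sigma> where \<sigma>: "\<And>i. \<sigma> i = 1 \<or> \<sigma> i = (-1 :: complex)"
      "Re (gram l n lam (\<lambda>i. \<sigma> i * (c i / of_real (r i)))) \<le> (\<Sum>i<n. (cmod (c i / of_real (r i)))\<^sup>2 * ?L i)"
      using balancing_signs[OF l, where n = n and x = lam and c = "\<lambda>i. c i / of_real (r i)"] by blast
    \<comment> \<open>The signs serve both as weights and inside the coefficients, so they cancel on
      the side of \<open>s\<close> while keeping the side of \<open>l\<close> balanced.\<close>
    have "cnj (\<sigma> i) * (of_real (r i) * (\<sigma> i * (c i / of_real (r i)))) = c i" for i
      using \<sigma>(1)[of i] r(1)[of i] by (elim disjE) simp_all
    moreover have "cmod (\<sigma> i) \<le> 1" for i
      using \<sigma>(1)[of i] by (elim disjE) simp_all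
    ultimately have "Re (gram s n lam c) \<le> M * Re (gram l n lam (\<lambda>i. \<sigma> i * (c i / of_real (r i))))"
      using M(2)[of \<sigma> n "\<lambda>i. \<sigma> i * (c i / of_real (r i))"] by (simp only: simp_thms)
    also have "\<dots> \<le> M * (\<Sum>i<n. (cmod (c i / of_real (r i)))\<^sup>2 * ?L i)"
      using \<sigma>(2) M(1) by simp
    also have "(\<Sum>i<n. (cmod (c i / of_real (r i)))\<^sup>2 * ?L i) = (\<Sum>i<n. (cmod (c i))\<^sup>2 * ?S i)"
      using s_pos l_pos by (intro sum.cong refl) (simp add: norm_divide power_divide r(2) less_imp_neq[symmetric])
    finally show ?thesis .
  qed
  then have "psd_kernel (\<lambda>i j. (if i = j then of_real (M * ?S i) else 0) - s (lam i) (lam j))"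
    unfolding carleson_form[OF s] by blast
  then show "carleson s lam" unfolding carleson_iff[OF s s_pos] using M(1) by blast
  show "strongly_separated l lam"
    unfolding strongly_separated_iff[OF l l_pos]
  proof (intro exI[of _ "1 / sqrt M"] conjI allI impI)
    fix i n :: nat and c :: "nat \<Rightarrow> complex" assume i: "i < n"
    \<comment> \<open>Unit weights at \<open>i\<close> leave only the \<open>i\<close>-th term on
      the side of \<open>s\<close>, which is \<open>(cmod (c i))^2 * ?L i\<close>.\<close>
    let ?e = "\<lambda>p. if p = i then 1 else 0 :: complex"
    have "(\<lambda>p. cnj (?e p) * (of_real (r p) * c p)) = (\<lambda>p. if p = i then of_real (r i) * c i else 0)"
      by auto
    then have "gram s n lam (\<lambda>p. cnj (?e p) * (of_real (r p) * c p))
        = of_real ((cmod (of_real (r i) * c i))\<^sup>2) * of_real (?S i)"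
      by (simp only: gram_single[OF i] psd_diag_of_real[OF s])
    also have "\<dots> = of_real ((cmod (c i))\<^sup>2 * ?L i)"
    proof -
      have "(cmod (of_real (r i) * c i))\<^sup>2 * ?S i = (cmod (c i))\<^sup>2 * ?L i"
        using s_pos[of "lam i"] by (simp add: norm_mult power_mult_distrib r(2))
      then show ?thesis by (simp only: of_real_mult[symmetric])
    qed
    finally have "gram s n lam (\<lambda>p. cnj (?e p) * (of_real (r p) * c p)) = of_real ((cmod (c i))\<^sup>2 * ?L i)" .
    then have "(cmod (c i))\<^sup>2 * ?L i \<le> M * Re (gram l n lam c)"
      using M(2)[of ?e n c] by simp
    then show "(1 / sqrt M)\<^sup>2 * (cmod (c i))\<^sup>2 * ?L i \<le> Re (gram l n lam c)"
      using M(1) by (simp add: power_divide field_simps)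
  qed (use M(1) in simp)
qed

theorem theorem3p2:
  fixes b :: "'x \<Rightarrow> 'k \<Rightarrow> complex"
    and s l g :: "'x \<Rightarrow> 'x \<Rightarrow> complex"
    and lam :: "nat \<Rightarrow> 'x"
  assumes "ncp_kernel b s"
    and "psd_kernel l"
    and "psd_kernel g"
    and "\<And>z w. l z w = s z w * g z w"
    and "\<And>z. (\<lambda>x. l x z) \<noteq> (\<lambda>x. 0)"
  shows "(interpolating s l lam \<longleftrightarrow> carleson s lam \<and> strongly_separated l lam) \<and>
         (interpolating s l lam \<longrightarrow>
            (\<exists>T :: (nat \<Rightarrow> complex) \<Rightarrow> ('x \<Rightarrow> complex).
               (\<forall>w \<in> linfty. is_mult s l (T w)) \<and>
               (\<forall>a. \<forall>v \<in> linfty. \<forall>w \<in> linfty.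
                   T (\<lambda>i. a * v i + w i) = (\<lambda>z. a * T v z + T w z)) \<and>
               (\<exists>M. \<forall>w \<in> linfty. mult_norm s l (T w) \<le> M * linfty_norm w) \<and>
               (\<forall>w \<in> linfty. \<forall>j. T w (lam j) =
                   w j * complex_of_real (kfun_norm l (lam j) / kfun_norm s (lam j)))))"
proof -
  note l = assms(2) and g = assms(3) and lsg = assms(4)
  interpret pick_kernel "\<lambda>z w. \<Sum>\<^sub>\<infinity>j. b z j * cnj (b w j)" s
    by (rule ncp_kernel_pick[OF assms(1)])
  have s_pos: "0 < Re (s z z)" for z using s_diag[of z] by simp
  \<comment> \<open>By Cauchy-Schwarz a vanishing diagonal value at \<open>z\<close> would make the
    whole function \<open>l_z\<close> zero.\<close>
  have l_pos: "0 < Re (l z z)" for z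
  proof -
    obtain x where "l x z \<noteq> 0" using assms(5)[of z] by auto
    then have "0 < Re (l x x) * Re (l z z)"
      using psd_cauchy_schwarz_points[OF l, of x z] by (metis less_le_trans norm_eq_zero zero_less_power2)
    then show ?thesis using psd_diag_Re[OF l, of z] by (auto simp: zero_less_mult_iff)
  qed
  have ratio: "kfun_norm l z / kfun_norm s z = sqrt (Re (l z z) / Re (s z z))" for z
    by (simp add: kfun_norm_eq psd_s l real_sqrt_divide)
  have operator: "\<exists>T. (\<forall>w \<in> linfty. is_mult s l (T w)) \<and>
               (\<forall>a. \<forall>v \<in> linfty. \<forall>w \<in> linfty.
                   T (\<lambda>i. a * v i + w i) = (\<lambda>z. a * T v z + T w z)) \<and>
               (\<exists>M. \<forall>w \<in> linfty. mult_norm s l (T w) \<le> M * linfty_norm w) \<and>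
               (\<forall>w \<in> linfty. \<forall>j. T w (lam j) =
                   w j * complex_of_real (kfun_norm l (lam j) / kfun_norm s (lam j)))"
    if carl: "carleson s lam" and sep: "strongly_separated l lam"
  proof -
    obtain D where D: "\<And>i n. (\<Sum>j<n. overlap (lam i) (lam j)) \<le> D"
      using carleson_overlap[OF carl] by blast
    obtain \<epsilon> where \<epsilon>: "0 < \<epsilon>" "\<And>i n c. i < n \<Longrightarrow> \<epsilon>\<^sup>2 * (cmod (c i))\<^sup>2 * Re (l (lam i) (lam i)) \<le> Re (gram l n lam c)"
      using sep unfolding strongly_separated_iff[OF l l_pos] by blast
    define \<kappa> where "\<kappa> = \<epsilon>\<^sup>2 * (1/4 * exp (-3 * D))"
    have \<kappa>: "0 < \<kappa>" using \<epsilon>(1) by (simp add: \<kappa>_def)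
    have riesz: "\<kappa> * (\<Sum>i<n. (cmod (c i))\<^sup>2 * Re (l (lam i) (lam i))) \<le> Re (gram l n lam c)" for n c
      unfolding \<kappa>_def by (rule riesz_lower[OF g lsg D \<epsilon>(2)])
    obtain C where C: "0 < C" "psd_kernel (\<lambda>i j. (if i = j then of_real (C * Re (s (lam i) (lam i))) else 0) - s (lam i) (lam j))"
      using carl unfolding carleson_iff[OF psd_s s_pos] by blast
    obtain A where A: "\<And>i j. A i (lam j) = (if i = j then of_real (sqrt (Re (l (lam i) (lam i)) / Re (s (lam i) (lam i)))) else 0)"
      "\<And>n w. \<forall>i. cmod (w i) \<le> 1 \<Longrightarrow> psd_kernel (\<lambda>x y. of_real ((C + 1) / \<kappa>) * l x y -
        (\<Sum>i<n. w i * A i x) * cnj (\<Sum>i<n. w i * A i y) * s x y)"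
      using interpolation_sequence[OF g lsg l_pos \<kappa> riesz C] by blast
    have M: "0 \<le> (C + 1) / \<kappa>" using C(1) \<kappa> by simp
    have op1: "summable (\<lambda>i. w i * A i z)" if "w \<in> linfty" for w z
      by (rule interpolation_operator(1)[where l = l, OF l_pos M A(2) that])
    have op2: "0 \<le> linfty_norm w" if "w \<in> linfty" for w
      by (rule interpolation_operator(2)[where l = l, OF l_pos M A(2) that])
    have op3: "psd_kernel (\<lambda>x y. of_real ((sqrt ((C + 1) / \<kappa>) * linfty_norm w)\<^sup>2) * l x y -
        (\<Sum>i. w i * A i x) * cnj (\<Sum>i. w i * A i y) * s x y)" if "w \<in> linfty" for w
      by (rule interpolation_operator(3)[where l = l, OF l_pos M A(2) that])
    \<comment> \<open>The functions \<open>A i\<close> are fixed before \<open>w\<close>, so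
      \<open>T\<close> is linear wherever the series converge; at \<open>lam j\<close> only the term
      \<open>i = j\<close> survives.\<close>
    define T where "T w z = (\<Sum>i. w i * A i z)" for w z
    have mult: "is_mult s l (T w)" "mult_norm s l (T w) \<le> sqrt ((C + 1) / \<kappa>) * linfty_norm w" if w: "w \<in> linfty" for w
      using is_multI[OF psd_s _ op3[OF w, folded T_def]] op2[OF w] M by simp_all
    have lin: "T (\<lambda>i. a * v i + w i) = (\<lambda>z. a * T v z + T w z)" if v: "v \<in> linfty" and w: "w \<in> linfty" for a v w
    proof
      fix z
      have "(\<Sum>i. a * (v i * A i z) + w i * A i z) = (\<Sum>i. a * (v i * A i z)) + (\<Sum>i. w i * A i z)"
        using op1[OF v] op1[OF w] by (intro suminf_add[symmetric] summable_mult)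
      also have "(\<Sum>i. a * (v i * A i z)) = a * (\<Sum>i. v i * A i z)"
        by (rule suminf_mult[OF op1[OF v]])
      finally show "T (\<lambda>i. a * v i + w i) z = a * T v z + T w z"
        by (simp add: T_def distrib_right mult.assoc)
    qed
    have val: "T w (lam j) = w j * complex_of_real (kfun_norm l (lam j) / kfun_norm s (lam j))" for w j
    proof -
      have "T w (lam j) = (\<Sum>i\<in>{j}. w i * A i (lam j))"
        unfolding T_def by (rule suminf_finite) (auto simp: A(1))
      then show ?thesis unfolding ratio by (simp add: A(1))
    qed
    show ?thesis using mult lin val by blast
  qed
  have "interpolating s l lam" if "carleson s lam" "strongly_separated l lam"
    using operator[OF that] unfolding interpolating_def by blast
  then have iff: "interpolating s l lam \<longleftrightarrow> carleson s lam \<and> strongly_separated l lam"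
    using interpolating_necessary[OF psd_s l s_pos l_pos] by blast
  with operator show ?thesis by blast
qed

end
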